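(* Let $C=(C_{ijkl})_{1\le i,j,k,l\le 3}$ be a real fourth order tensor with the symmetries $C_{ijkl}=C_{kjil}=C_{ilkj}$ for all $1\le i,j,k,l\le 3$, and let $$f(\xi)=\sum_{1\le i,j,k,l\le 3}C_{ijkl}\,\xi_{ij}\xi_{kl},\qquad \xi\in\mathbb R^{3\times 3},$$ be the associated quadratic form. Assume that $f\in\mathcal C_3$, i.e. $f$ is quasiconvex, and let $T(y)$ be the $3\times 3$ acoustic tensor ($y$-matrix) of $f$, so that $f(x\otimes y)=x\,T(y)\,x^T$ for all $x,y\in\mathbb R^3$. Assume that $\det(T(y))=0$ for all $y\in\mathbb R^3$. Then $f$ is polyconvex.
   Context: For $x,y\in\mathbb R^3$, $x\otimes y$ is the $3\times 3$ matrix with entries $(x\otimes y)_{ij}=x_iy_j$. Quasiconvexity: a quadratic form $f:\mathbb R^{3\times 3}\to\mathbb R$ is quasiconvex if and only if it is rank-one convex, equivalently $f(x\otimes y)\ge 0$ for all $x,y\in\mathbb R^3$. $\mathcal C_3$ denotes the convex cone of quasiconvex quadratic forms on $\mathbb R^{3\times 3}$. Acoustic tensor ($y$-matrix): $T(y)$ is the symmetric $3\times 3$ matrix with entries $T(y)_{ik}=\sum_{j,l=1}^3C_{ijkl}\,y_jy_l$, which are quadratic forms in $y$. Polyconvex: $f:\mathbb R^{3\times 3}\to\mathbb R$ is polyconvex if $f(\xi)$ is a convex function of the collection of all minors (of all orders, including first order) of $\xi$. For a quadratic form $f$ this is equivalent to $f$ being the sum of a convex (i.e. positive semidefinite) quadratic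 form and a linear combination of the $2\times 2$ minors of $\xi$, and equivalent to the biquadratic form $f(x\otimes y)$ being a sum of squares of bilinear forms in $(x,y)$. *)

theory Defs
  imports "HOL-Analysis.Analysis"
begin

text \<open>
  A matrix \<open>\<xi> :: real^3^3\<close> has entries \<open>\<xi>$i$j\<close> (row \<open>i\<close>, column \<open>j\<close>). The gradient of
  \<open>\<phi> :: real^3 \<Rightarrow> real^3\<close> is its Jacobian, with \<open>j\<close>-th partial derivative of the \<open>i\<close>-th
  component in position \<open>(i, j)\<close>.
\<close>

definition outer :: "real^3 \<Rightarrow> real^3 \<Rightarrow> real^3^3" where
  "outer x y = (\<chi> i j. x$i * y$j)"

definition quad_form :: "(3 \<Rightarrow> 3 \<Rightarrow> 3 \<Rightarrow> 3 \<Rightarrow> real) \<Rightarrow> real^3^3 \<Rightarrow> real" where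
  "quad_form C \<xi> = (\<Sum>i\<in>UNIV. \<Sum>j\<in>UNIV. \<Sum>k\<in>UNIV. \<Sum>l\<in>UNIV. C i j k l * \<xi>$i$j * \<xi>$k$l)"

definition acoustic :: "(3 \<Rightarrow> 3 \<Rightarrow> 3 \<Rightarrow> 3 \<Rightarrow> real) \<Rightarrow> real^3 \<Rightarrow> real^3^3" where
  "acoustic C y = (\<chi> i k. \<Sum>j\<in>UNIV. \<Sum>l\<in>UNIV. C i j k l * y$j * y$l)"

text \<open>
  Morrey's quasiconvexity, with \<open>C\<^sup>1\<close> test fields of compact support in the domain. It is meant
  for continuous \<open>f\<close>, for which the integrand is integrable over \<open>D\<close> and for which testing
  with all Lipschitz fields vanishing on the boundary gives the same notion, by density. For a
  quadratic form it is equivalent to \<open>f (outer x y) \<ge> 0\<close> for all \<open>x\<close> and \<open>y\<close>; that fact is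
  deliberately not built into the definition.
\<close>

definition test_field :: "(real^3) set \<Rightarrow> (real^3 \<Rightarrow> real^3) \<Rightarrow> (real^3 \<Rightarrow> real^3^3) \<Rightarrow> bool" where
  "test_field D \<phi> grad \<longleftrightarrow>
     (\<forall>x. (\<phi> has_derivative (\<lambda>h. grad x *v h)) (at x)) \<and>
     continuous_on UNIV grad \<and>
     (\<exists>K. compact K \<and> K \<subseteq> D \<and> (\<forall>x. x \<notin> K \<longrightarrow> \<phi> x = 0))"

definition quasiconvex :: "(real^3^3 \<Rightarrow> real) \<Rightarrow> bool" where
  "quasiconvex f \<longleftrightarrow>
     (\<forall>D \<xi> \<phi> grad. open D \<longrightarrow> bounded D \<longrightarrow> test_field D \<phi> grad \<longrightarrow>
        measure lebesgue D * f \<xi> \<le> integral D (\<lambda>x. f (\<xi> + grad x)))"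

definition quasiconvex_quadratic_forms :: "(real^3^3 \<Rightarrow> real) set" where
  "quasiconvex_quadratic_forms =
     {f. (\<exists>B. bilinear B \<and> (\<forall>\<xi>. f \<xi> = B \<xi> \<xi>)) \<and> quasiconvex f}"

text \<open>
  Indices of type \<open>3\<close> are added modulo 3, so the cyclic shifts below already produce the usual
  signs of the cofactors; up to sign the entries are exactly the nine minors of order two.
\<close>

definition cofactor_matrix :: "real^3^3 \<Rightarrow> real^3^3" where
  "cofactor_matrix \<xi> =
     (\<chi> i j. \<xi>$(i+1)$(j+1) * \<xi>$(i+2)$(j+2) - \<xi>$(i+1)$(j+2) * \<xi>$(i+2)$(j+1))"

definition polyconvex :: "(real^3^3 \<Rightarrow> real) \<Rightarrow> bool" where
  "polyconvex f \<longleftrightarrow>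
     (\<exists>g :: (real^3^3) \<times> (real^3^3) \<times> real \<Rightarrow> real.
        convex_on UNIV g \<and> (\<forall>\<xi>. f \<xi> = g (\<xi>, cofactor_matrix \<xi>, det \<xi>)))"

lemma quad_form_outer: "quad_form C (outer x y) = x \<bullet> (acoustic C y *v x)"
  by (simp add: quad_form_def outer_def acoustic_def inner_vec_def matrix_vector_mult_def
      sum_3 algebra_simps)

lemma cofactor_matrix_mult: "\<xi> ** transpose (cofactor_matrix \<xi>) = mat (det \<xi>)"
proof -
  have idx: "(4::3) = 1" "(5::3) = 2"
    by simp_all
  show ?thesis
    unfolding vec_eq_iff forall_3
    by (simp add: matrix_matrix_mult_def transpose_def mat_def cofactor_matrix_def det_3 sum_3
        idx algebra_simps)
qed

lemma quad_form_mem_iff: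
  "quad_form C \<in> quasiconvex_quadratic_forms \<longleftrightarrow> quasiconvex (quad_form C)"
proof -
  define B :: "real^3^3 \<Rightarrow> real^3^3 \<Rightarrow> real" where
    "B \<xi> \<eta> = (\<Sum>i\<in>UNIV. \<Sum>j\<in>UNIV. \<Sum>k\<in>UNIV. \<Sum>l\<in>UNIV. C i j k l * \<xi>$i$j * \<eta>$k$l)" for \<xi> \<eta>
  have "bilinear B"
    unfolding bilinear_def linear_iff B_def
    by (simp add: sum.distrib sum_distrib_left algebra_simps)
  moreover have "quad_form C \<xi> = B \<xi> \<xi>" for \<xi>
    by (simp add: quad_form_def B_def)
  ultimately show ?thesis
    unfolding quasiconvex_quadratic_forms_def by blast
qed

end

theory Submission
  imports Defs
begin

text \<open>
  Testing quasiconvexity with the fields \<open>a \<psi>(x) sin(n y\<cdot>x)\<close> and \<open>a \<psi>(x) cos(n y\<cdot>x)\<close> gives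
  \<open>f(a \<otimes> y) \<ge> 0\<close>, so it remains to write \<open>f(x \<otimes> y)\<close> as a sum of squares of bilinear forms.
  The main tool is that a nonnegative biquadratic form is such a sum if one of the two variables
  is two-dimensional: subtract a multiple of \<open>|x|\<^sup>2|y|\<^sup>2\<close> until a zero appears, and complete the
  square along that zero to drop a dimension of the other variable.

  Choose \<open>d\<close> with \<open>T(d) \<noteq> 0\<close>. If \<open>T(d)\<close> has rank one, completing the square in the direction \<open>d\<close>
  leaves a form in which \<open>y\<close> is two-dimensional. If \<open>T(d) = diag(0, 1, 1)\<close> in a basis \<open>e1, e2, e3\<close>,
  write \<open>y = t d + w\<close>; the coefficients of \<open>t\<^sup>4\<close> and \<open>t\<^sup>3\<close> in \<open>det T(t d + w) = 0\<close> show that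
  \<open>f(e1 \<otimes> y) = |l(w)|\<^sup>2\<close> for a linear map \<open>l\<close> into the plane, and determine the
  \<open>x1\<close>-terms of \<open>f\<close> up to a linear form \<open>s(w)\<close>. When \<open>l\<close> has rank at most one, the previous cases
  apply with \<open>x\<close> and \<open>y\<close> exchanged. Otherwise \<open>l(w) = w\<close> after a change of basis, and with
  \<open>x' = (x2, x3)\<close> one gets \<open>f = |t x' + x1 w + K(w) x'|\<^sup>2 + E(x', w)\<close>. For linearly independent \<open>x'\<close>
  and \<open>w\<close> the square vanishes for suitable \<open>t\<close> and \<open>x1\<close>, so \<open>E \<ge> 0\<close>, and \<open>E\<close> is a form in two
  two-dimensional variables.
\<close>

section \<open>Sums of squares and pencils of quadratic forms\<close>

text \<open>The number of squares stays unspecified, so closure under sums, scaling, substitution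
  and exchange of the variables follows by rule induction.\<close>

inductive sos :: "('a::real_vector \<Rightarrow> 'b::real_vector \<Rightarrow> real) \<Rightarrow> bool" where
  sos_zero: "sos (\<lambda>x y. 0)"
| sos_add_square: "sos f \<Longrightarrow> bilinear b \<Longrightarrow> sos (\<lambda>x y. f x y + (b x y)\<^sup>2)"

lemma sos_square: "bilinear b \<Longrightarrow> sos (\<lambda>x y. (b x y)\<^sup>2)"
  using sos_add_square[OF sos_zero] by simp

lemma sos_add:
  assumes "sos f" "sos g"
  shows "sos (\<lambda>x y. f x y + g x y)"
  using assms(2)
proof induction
  case sos_zero
  then show ?case using assms(1) by simp
next
  case (sos_add_square g b)
  then show ?case
    using sos.sos_add_square[of "\<lambda>x y. f x y + g x y" b] by (simp add: add.assoc)
qed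

lemma sos_sum:
  assumes "finite I" "\<And>i. i \<in> I \<Longrightarrow> sos (f i)"
  shows "sos (\<lambda>x y. \<Sum>i\<in>I. f i x y)"
  using assms by induction (auto intro: sos_zero sos_add)

lemma sos_scale:
  assumes "sos f" "0 \<le> c"
  shows "sos (\<lambda>x y. c * f x y)"
  using assms(1)
proof induction
  case sos_zero
  then show ?case using sos.sos_zero by simp
next
  case (sos_add_square f b)
  have "bilinear (\<lambda>x y. sqrt c * b x y)"
    using sos_add_square.hyps(2) unfolding bilinear_def linear_iff by (simp add: algebra_simps)
  from sos.sos_add_square[OF sos_add_square.IH this] show ?case
    using \<open>0 \<le> c\<close> by (simp add: power_mult_distrib algebra_simps)
qed

lemma sos_compose:
  assumes "sos f" "linear g" "linear h"
  shows "sos (\<lambda>x y. f (g x) (h y))"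
  using assms(1)
proof induction
  case sos_zero
  then show ?case by (rule sos.sos_zero)
next
  case (sos_add_square f b)
  have "bilinear (\<lambda>x y. b (g x) (h y))"
    using sos_add_square.hyps(2) assms(2,3) unfolding bilinear_def linear_iff by simp
  from sos.sos_add_square[OF sos_add_square.IH this] show ?case .
qed

lemma sos_swap:
  assumes "sos f"
  shows "sos (\<lambda>x y. f y x)"
  using assms
proof induction
  case sos_zero
  then show ?case by (rule sos.sos_zero)
next
  case (sos_add_square f b)
  have "bilinear (\<lambda>x y. b y x)"
    using sos_add_square.hyps(2) unfolding bilinear_def by simp
  from sos.sos_add_square[OF sos_add_square.IH this] show ?case .
qed

lemma bilinear_mult_linear:
  fixes g :: "'a::real_vector \<Rightarrow> real" and h :: "'b::real_vector \<Rightarrow> real"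
  assumes "linear g" "linear h"
  shows "bilinear (\<lambda>x y. g x * h y)"
  using assms unfolding bilinear_def linear_iff by (simp add: algebra_simps)

lemma bilinear_add:
  "bilinear b \<Longrightarrow> bilinear c \<Longrightarrow> bilinear (\<lambda>x y. b x y + c x y)"
  unfolding bilinear_def linear_iff by (simp add: algebra_simps)

lemma bilinear_cmult:
  fixes b :: "'a::real_vector \<Rightarrow> 'b::real_vector \<Rightarrow> real"
  shows "bilinear b \<Longrightarrow> bilinear (\<lambda>x y. r * b x y)"
  unfolding bilinear_def linear_iff by (simp add: algebra_simps)

text \<open>Continuity at \<open>0\<close>. It serves where nonnegativity is first obtained only off
  a degenerate set.\<close>

lemma quadratic_nonneg_at_0:
  fixes a b c :: real
  assumes "\<And>e. e \<noteq> 0 \<Longrightarrow> 0 \<le> a + b * e + c * e\<^sup>2"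
  shows "0 \<le> a"
proof (rule tendsto_lowerbound)
  show "((\<lambda>e. a + b * e + c * e\<^sup>2) \<longlongrightarrow> a) (at 0)"
    by (auto intro!: tendsto_eq_intros)
  show "\<forall>\<^sub>F e in at 0. 0 \<le> a + b * e + c * e\<^sup>2"
    using assms by (simp add: eventually_at_filter)
qed simp

lemma affine_nonneg_imp_slope_0:
  fixes a b :: real
  assumes "\<And>t. 0 \<le> a + b * t"
  shows "b = 0"
proof (rule ccontr)
  assume "b \<noteq> 0"
  \<comment> \<open>At this point the affine function takes the value \<open>-1\<close>.\<close>
  with assms[of "- (a + 1) / b"] show False by simp
qed

text \<open>For \<open>u = 1\<close> the expression is affine in \<open>s\<close>. In matrix terms,
  a zero diagonal entry of a positive semidefinite 2 by 2 matrix forces the off-diagonal entry to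
  vanish.\<close>

lemma psd_pair_isotropic:
  fixes b c :: real
  assumes "\<And>s u. 0 \<le> 2 * s * u * b + u\<^sup>2 * c"
  shows "b = 0"
  using affine_nonneg_imp_slope_0[of c "2 * b"] assms[of _ 1] by (simp add: algebra_simps)

section \<open>Symmetric bilinear forms and their isotropic vectors\<close>

definition symbilinear :: "('a::real_vector \<Rightarrow> 'a \<Rightarrow> real) \<Rightarrow> bool" where
  "symbilinear A \<longleftrightarrow> bilinear A \<and> (\<forall>x y. A x y = A y x)"

lemma symbilinearD:
  assumes "symbilinear A"
  shows "A (x + y) z = A x z + A y z" "A z (x + y) = A z x + A z y"
    "A (r *\<^sub>R x) z = r * A x z" "A z (r *\<^sub>R x) = r * A z x"
    "A (x - y) z = A x z - A y z" "A z (x - y) = A z x - A z y"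
    "A 0 z = 0" "A z 0 = 0"
  using assms unfolding symbilinear_def
  by (auto simp: bilinear_ladd bilinear_radd bilinear_lmul bilinear_rmul bilinear_lsub
      bilinear_rsub bilinear_lzero bilinear_rzero)

lemma symbilinear_commute: "symbilinear A \<Longrightarrow> A x y = A y x"
  unfolding symbilinear_def by blast

lemma symbilinear_linear: "symbilinear A \<Longrightarrow> linear (A x)"
  unfolding symbilinear_def bilinear_def by blast

lemma symbilinear_add:
  "symbilinear A \<Longrightarrow> symbilinear B \<Longrightarrow> symbilinear (\<lambda>x y. A x y + B x y)"
  unfolding symbilinear_def bilinear_def linear_iff by (simp add: algebra_simps)

lemma symbilinear_diff:
  "symbilinear A \<Longrightarrow> symbilinear B \<Longrightarrow> symbilinear (\<lambda>x y. A x y - B x y)"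
  unfolding symbilinear_def bilinear_def linear_iff by (simp add: algebra_simps)

lemma symbilinear_cmult: "symbilinear A \<Longrightarrow> symbilinear (\<lambda>x y. r * A x y)"
  unfolding symbilinear_def bilinear_def linear_iff by (simp add: algebra_simps)

lemma symbilinear_inner: "symbilinear (\<lambda>x y :: 'a::real_inner. x \<bullet> y)"
  unfolding symbilinear_def bilinear_def linear_iff
  by (simp add: inner_add_left inner_add_right inner_commute)

lemma symbilinear_mult:
  "linear g \<Longrightarrow> linear h \<Longrightarrow> symbilinear (\<lambda>x y. g x * h y + g y * h x)"
  unfolding symbilinear_def bilinear_def linear_iff by (simp add: algebra_simps)

lemma symbilinear_mult_self:
  "linear g \<Longrightarrow> symbilinear (\<lambda>x y. g x * g y)"
  unfolding symbilinear_def bilinear_def linear_iff by (simp add: algebra_simps)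

lemma symbilinear_continuous_on:
  fixes A :: "'b::euclidean_space \<Rightarrow> 'b \<Rightarrow> real"
  assumes "symbilinear A" "continuous_on S g"
  shows "continuous_on S (\<lambda>x. A (g x) (g x))"
proof -
  have "bounded_bilinear A"
    using assms(1) by (simp add: symbilinear_def bilinear_conv_bounded_bilinear)
  from bounded_bilinear.continuous_on[OF this assms(2,2)] show ?thesis .
qed

text \<open>Along the line \<open>y + t w\<close> the form is affine in \<open>t\<close>, because
  the coefficient \<open>A w w\<close> of the square of \<open>t\<close> vanishes. Being
  nonnegative, it has slope \<open>2 * A w y = 0\<close>.\<close>

lemma symbilinear_isotropic:
  assumes "symbilinear A" "subspace S" "\<And>y. y \<in> S \<Longrightarrow> 0 \<le> A y y" "w \<in> S" "A w w = 0" "y \<in> S"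
  shows "A w y = 0"
proof -
  have "0 \<le> A y y + (2 * A w y) * t" for t
  proof -
    have "y + t *\<^sub>R w \<in> S"
      using assms by (simp add: subspace_add subspace_scale)
    from assms(3)[OF this] show ?thesis
      by (simp add: symbilinearD[OF assms(1)] assms(5) symbilinear_commute[OF assms(1), of y w]
          algebra_simps)
  qed
  from affine_nonneg_imp_slope_0[OF this] show ?thesis by simp
qed

text \<open>The general biquadratic form whose first variable \<open>(s, u)\<close> is
  two-dimensional: \<open>A\<close>, \<open>B\<close>, \<open>C\<close> are the entries of its
  symmetric 2 by 2 matrix, each a form in \<open>y\<close>.\<close>

definition pencil :: "('b \<Rightarrow> 'b \<Rightarrow> real) \<Rightarrow> ('b \<Rightarrow> 'b \<Rightarrow> real) \<Rightarrow> ('b \<Rightarrow> 'b \<Rightarrow> real) \<Rightarrow>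
    real \<times> real \<Rightarrow> 'b \<Rightarrow> real" where
  "pencil A B C = (\<lambda>(s, u) y. s\<^sup>2 * A y y + 2 * s * u * B y y + u\<^sup>2 * C y y)"

text \<open>The pencil vanishes at \<open>x = (1, 0)\<close>, \<open>y = w\<close>, so isotropy
  kills \<open>A w y\<close> and \<open>B w w\<close>. On \<open>y + t w\<close> only
  \<open>c (u t)^2 + 2 u t q\<close> depends on \<open>t\<close>, where
  \<open>q = 2 s B w y + u C w y\<close>. Completing this square leaves a remainder free of
  \<open>t\<close>, hence a form in the projection of \<open>y\<close> orthogonal to
  \<open>w\<close>.\<close>

lemma pencil_deflate:
  fixes A B C :: "'b::euclidean_space \<Rightarrow> 'b \<Rightarrow> real"
  assumes S: "subspace S" "w \<in> S" "norm w = 1"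
    and AA: "symbilinear A" and BB: "symbilinear B" and CC: "symbilinear C"
    and nonneg: "\<And>x y. y \<in> S \<Longrightarrow> 0 \<le> pencil A B C x y"
    and zero: "A w w = 0"
  obtains A' B' C' b where "symbilinear A'" "symbilinear B'" "symbilinear C'" "bilinear b"
    "\<And>x y. y \<in> S \<Longrightarrow> y \<bullet> w = 0 \<Longrightarrow> 0 \<le> pencil A' B' C' x y"
    "\<And>x y. y \<in> S \<Longrightarrow> pencil A B C x y = (b x y)\<^sup>2 + pencil A' B' C' x (y - (y \<bullet> w) *\<^sub>R w)"
proof -
  define c where "c = C w w"
  \<comment> \<open>If \<open>c = 0\<close>, the terms divided by \<open>c\<close> are \<open>0\<close> and no square is split off.\<close>
  define A' where "A' = (\<lambda>y z. A y z - (4 / c) * (B w y * B w z))"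
  define B' where "B' = (\<lambda>y z. B y z - (1 / c) * (B w y * C w z + B w z * C w y))"
  define C' where "C' = (\<lambda>y z. C y z - (1 / c) * (C w y * C w z))"
  define \<pi> where "\<pi> = (\<lambda>y. y - (y \<bullet> w) *\<^sub>R w)"
  define b :: "real \<times> real \<Rightarrow> 'b \<Rightarrow> real" where
    "b = (\<lambda>x y. sqrt c * (snd x * (y \<bullet> w)) + (1 / sqrt c) * (2 * (fst x * B w (\<pi> y)) + snd x * C w (\<pi> y)))"
  have lin: "linear (B w)" "linear (C w)"
    using BB CC by (simp_all add: symbilinear_linear)
  have lin\<pi>: "linear (\<lambda>y. B w (\<pi> y))" "linear (\<lambda>y. C w (\<pi> y))" "linear (\<lambda>y. y \<bullet> w)"
    unfolding linear_iff \<pi>_def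
    by (simp_all add: symbilinearD[OF BB] symbilinearD[OF CC] inner_add_left algebra_simps)
  have 1: "symbilinear A'" "symbilinear B'" "symbilinear C'"
    unfolding A'_def B'_def C'_def
    by (intro symbilinear_diff AA BB CC symbilinear_cmult symbilinear_mult_self symbilinear_mult lin)+
  have 2: "bilinear b"
    unfolding b_def
    by (intro bilinear_add bilinear_cmult bilinear_mult_linear lin\<pi> linear_fst linear_snd)
  have A0: "A w y = 0" if "y \<in> S" for y
  proof (rule symbilinear_isotropic[OF AA S(1) _ S(2) zero that])
    fix z assume "z \<in> S"
    from nonneg[OF this, of "(1, 0)"] show "0 \<le> A z z" by (simp add: pencil_def)
  qed
  have B0: "B w w = 0"
  proof (rule psd_pair_isotropic)
    fix s u :: real
    from nonneg[OF S(2), of "(s, u)"] show "0 \<le> 2 * s * u * B w w + u\<^sup>2 * C w w"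
      using zero by (simp add: pencil_def)
  qed
  have c0: "0 \<le> c"
    using nonneg[OF S(2), of "(0, 1)"] by (simp add: pencil_def c_def)
  have expand: "pencil A B C (s, u) (y + t *\<^sub>R w) =
      pencil A B C (s, u) y + 2 * t * (u * (2 * s * B w y + u * C w y)) + c * (u * t)\<^sup>2"
    if "y \<in> S" for s u t y
    using A0[OF that] zero B0
    by (simp add: pencil_def symbilinearD[OF AA] symbilinearD[OF BB] symbilinearD[OF CC]
        symbilinear_commute[OF AA, of y w] symbilinear_commute[OF BB, of y w]
        symbilinear_commute[OF CC, of y w] c_def power2_eq_square algebra_simps)
  have step: "0 \<le> pencil A B C (s, u) y + 2 * t * (u * (2 * s * B w y + u * C w y)) + c * (u * t)\<^sup>2"
    if "y \<in> S" for s u t y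
    using nonneg[of "y + t *\<^sub>R w" "(s, u)"] that S
    by (simp add: expand subspace_add subspace_scale)
  \<comment> \<open>Without a quadratic term the nonnegative polynomial in \<open>t\<close> is
    affine, so its slope vanishes.\<close>
  have degenerate: "u * (2 * s * B w y + u * C w y) = 0" if "c = 0" "y \<in> S" for s u y
    using affine_nonneg_imp_slope_0[of "pencil A B C (s, u) y" "2 * (u * (2 * s * B w y + u * C w y))"]
      step[OF that(2), of s u] that(1) by (simp add: algebra_simps)
  \<comment> \<open>The coefficients of \<open>A'\<close>, \<open>B'\<close>, \<open>C'\<close> were
    chosen to subtract exactly \<open>q^2 / c\<close>.\<close>
  have pencil': "pencil A' B' C' (s, u) y = pencil A B C (s, u) y - (2 * s * B w y + u * C w y)\<^sup>2 / c"
    for s u y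
    by (simp add: pencil_def A'_def B'_def C'_def power2_eq_square add_divide_distrib
        diff_divide_distrib algebra_simps)
  have nn: "0 \<le> pencil A' B' C' (s, u) y" if "y \<in> S" "u \<noteq> 0" for s u y
  proof (cases "c = 0")
    case True
    then show ?thesis using step[OF that(1), of s u 0] by (simp add: pencil')
  next
    case False
    define q where "q = 2 * s * B w y + u * C w y"
    \<comment> \<open>The value of \<open>t\<close> is the vertex of the parabola, which exists
      because \<open>c\<close> and \<open>u\<close> are nonzero.\<close>
    have "2 * (- q / (c * u)) * (u * q) + c * (u * (- q / (c * u)))\<^sup>2 = - q\<^sup>2 / c"
      using False that(2) by (simp add: power2_eq_square field_simps)
    with step[OF that(1), of s u "- q / (c * u)"] show ?thesis
      by (simp add: pencil' q_def[symmetric])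
  qed
  have 3: "0 \<le> pencil A' B' C' x y" if "y \<in> S" for x y
  proof -
    obtain s u where x: "x = (s, u)" by fastforce
    show ?thesis
    proof (cases "u = 0")
      case True
      \<comment> \<open>The excluded case \<open>u = 0\<close> is the limit of \<open>u = e\<close>
        as \<open>e\<close> tends to \<open>0\<close>.\<close>
      have "0 \<le> s\<^sup>2 * A' y y + (2 * s * B' y y) * e + C' y y * e\<^sup>2" if "e \<noteq> 0" for e
      proof -
        have "pencil A' B' C' (s, e) y = s\<^sup>2 * A' y y + (2 * s * B' y y) * e + C' y y * e\<^sup>2"
          by (simp add: pencil_def)
        with nn[OF \<open>y \<in> S\<close> that, of s] show ?thesis by simp
      qed
      then have "0 \<le> s\<^sup>2 * A' y y" by (rule quadratic_nonneg_at_0)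
      then show ?thesis using True x by (simp add: pencil_def)
    qed (use nn that x in auto)
  qed
  have 4: "pencil A B C x y = (b x y)\<^sup>2 + pencil A' B' C' x (y - (y \<bullet> w) *\<^sub>R w)" if "y \<in> S" for x y
  proof -
    obtain s u where x: "x = (s, u)" by fastforce
    define z where "z = \<pi> y"
    have zS: "z \<in> S"
      using that S by (simp add: z_def \<pi>_def subspace_diff subspace_scale)
    have y: "y = z + (y \<bullet> w) *\<^sub>R w"
      by (simp add: z_def \<pi>_def)
    have "pencil A B C x y = pencil A B C (s, u) (z + (y \<bullet> w) *\<^sub>R w)"
      using y x by simp
    also have "\<dots> = (b x y)\<^sup>2 + pencil A' B' C' x z"
    proof (cases "c = 0")
      case True
      then show ?thesis
        using degenerate[OF True zS, of u s] by (simp add: expand[OF zS] pencil' x b_def)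
    next
      case False
      then have "sqrt c \<noteq> 0" "sqrt c * sqrt c = c" using c0 by auto
      then have square: "(sqrt c * p + (1 / sqrt c) * q)\<^sup>2 = c * p\<^sup>2 + 2 * p * q + q\<^sup>2 / c" for p q
        by (simp add: power2_eq_square field_simps)
      define q where "q = 2 * s * B w z + u * C w z"
      have "b x y = sqrt c * (u * (y \<bullet> w)) + (1 / sqrt c) * q"
        by (simp add: b_def x q_def z_def)
      then show ?thesis
        unfolding expand[OF zS] x pencil' q_def[symmetric]
        using square[of "u * (y \<bullet> w)" q] by simp
    qed
    finally show ?thesis by (simp add: z_def \<pi>_def)
  qed
  show ?thesis
    using that[OF 1 2 _ 4] 3 by blast
qed

text \<open>The multiple of this form that is subtracted to create a zero must itself be added back
  as squares.\<close>

lemma sos_norm_square: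
  "sos (\<lambda>(x :: real \<times> real) (y :: 'b::euclidean_space). (norm x)\<^sup>2 * (norm y)\<^sup>2)"
proof -
  have eq: "(norm x)\<^sup>2 * (norm y)\<^sup>2 = (\<Sum>i\<in>Basis. (fst x * (y \<bullet> i))\<^sup>2 + (snd x * (y \<bullet> i))\<^sup>2)"
    for x :: "real \<times> real" and y :: 'b
  proof -
    have "(norm y)\<^sup>2 = (\<Sum>i\<in>Basis. (y \<bullet> i)\<^sup>2)"
      unfolding power2_norm_eq_inner by (subst euclidean_inner) (simp add: power2_eq_square)
    moreover have "(norm x)\<^sup>2 = (fst x)\<^sup>2 + (snd x)\<^sup>2"
      by (simp add: norm_prod_def)
    ultimately show ?thesis
      by (simp add: distrib_right sum.distrib sum_distrib_left power_mult_distrib)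
  qed
  have lin: "linear (\<lambda>y. y \<bullet> i)" for i :: 'b
    by (simp add: linear_iff inner_add_left)
  show ?thesis
    unfolding eq
    by (intro sos_sum sos_add sos_square bilinear_mult_linear linear_fst linear_snd lin) simp
qed

text \<open>A rotation of the two-dimensional variable carries \<open>(1, 0)\<close> to
  \<open>(a, b)\<close>. It brings a minimizer into the position required by
  \<open>pencil_deflate\<close>; the second identity is the inverse rotation.\<close>

lemma pencil_rotate:
  fixes A B C :: "'b \<Rightarrow> 'b \<Rightarrow> real" and a b :: real
  assumes "a\<^sup>2 + b\<^sup>2 = 1"
  defines "A' \<equiv> \<lambda>y z. a\<^sup>2 * A y z + 2 * a * b * B y z + b\<^sup>2 * C y z"
    and "B' \<equiv> \<lambda>y z. (a\<^sup>2 - b\<^sup>2) * B y z + a * b * (C y z - A y z)"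
    and "C' \<equiv> \<lambda>y z. b\<^sup>2 * A y z - 2 * a * b * B y z + a\<^sup>2 * C y z"
  shows "pencil A B C (a * s - b * u, b * s + a * u) y = pencil A' B' C' (s, u) y"
    and "pencil A B C (s, u) y = pencil A' B' C' (a * s + b * u, a * u - b * s) y"
proof -
  show *: "pencil A B C (a * s - b * u, b * s + a * u) y = pencil A' B' C' (s, u) y" for s u
    by (simp add: pencil_def A'_def B'_def C'_def power2_eq_square algebra_simps)
  have "a * (a * s + b * u) - b * (a * u - b * s) = (a\<^sup>2 + b\<^sup>2) * s"
    "b * (a * s + b * u) + a * (a * u - b * s) = (a\<^sup>2 + b\<^sup>2) * u"
    by (simp_all add: power2_eq_square algebra_simps)
  with *[of "a * s + b * u" "a * u - b * s"] assms(1)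
  show "pencil A B C (s, u) y = pencil A' B' C' (a * s + b * u, a * u - b * s) y"
    by simp
qed

lemma pencil_scale:
  assumes "symbilinear A" "symbilinear B" "symbilinear C"
  shows "pencil A B C (p *\<^sub>R x) (q *\<^sub>R y) = p\<^sup>2 * q\<^sup>2 * pencil A B C x y"
  by (cases x) (simp add: pencil_def symbilinearD[OF assms(1)] symbilinearD[OF assms(2)]
      symbilinearD[OF assms(3)] power2_eq_square algebra_simps)

text \<open>The pencil attains its minimum on the compact product of the unit spheres, and
  homogeneity of degree two in each variable extends the bound to all vectors.\<close>

lemma pencil_minimum:
  fixes A B C :: "'b::euclidean_space \<Rightarrow> 'b \<Rightarrow> real"
  assumes "subspace S" "S \<noteq> {0}" "symbilinear A" "symbilinear B" "symbilinear C"
  obtains a b w where "a\<^sup>2 + b\<^sup>2 = 1" "w \<in> S" "norm w = 1"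
    "\<And>x y. y \<in> S \<Longrightarrow> pencil A B C (a, b) w * ((norm x)\<^sup>2 * (norm y)\<^sup>2) \<le> pencil A B C x y"
proof -
  let ?K = "sphere (0 :: real \<times> real) 1 \<times> (S \<inter> sphere 0 1)"
  let ?g = "\<lambda>p. pencil A B C (fst p) (snd p)"
  obtain v where v: "v \<in> S" "v \<noteq> 0"
    using assms(1,2) subspace_0 by blast
  have "(1 / norm v) *\<^sub>R v \<in> S \<inter> sphere 0 1"
    using v assms(1) by (simp add: subspace_scale)
  moreover have "(1, 0) \<in> sphere (0 :: real \<times> real) 1"
    by (simp add: norm_prod_def)
  ultimately have "?K \<noteq> {}" by blast
  moreover have "compact ?K"
    using assms(1) by (intro compact_Times closed_Int_compact closed_subspace) simp_all
  moreover have "continuous_on ?K ?g"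
    unfolding pencil_def case_prod_beta
    by (intro continuous_intros symbilinear_continuous_on[OF assms(3)]
        symbilinear_continuous_on[OF assms(4)] symbilinear_continuous_on[OF assms(5)])
  ultimately obtain p where p: "p \<in> ?K" "\<And>q. q \<in> ?K \<Longrightarrow> ?g p \<le> ?g q"
    using continuous_attains_inf[of ?K ?g] by blast
  obtain a b w where pw: "p = ((a, b), w)" by (metis surj_pair)
  have le: "pencil A B C (a, b) w * ((norm x)\<^sup>2 * (norm y)\<^sup>2) \<le> pencil A B C x y" if "y \<in> S" for x y
  proof (cases "x = 0 \<or> y = 0")
    case True
    then show ?thesis
      using pencil_scale[OF assms(3-5), of 0 x 1 y] pencil_scale[OF assms(3-5), of 1 x 0 y] by auto
  next
    case False
    let ?x = "(1 / norm x) *\<^sub>R x" and ?y = "(1 / norm y) *\<^sub>R y"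
    have "(?x, ?y) \<in> ?K"
      using False that assms(1) by (simp add: subspace_scale)
    from p(2)[OF this] have "pencil A B C (a, b) w \<le> pencil A B C ?x ?y"
      by (simp add: pw)
    then have "pencil A B C (a, b) w * ((norm x)\<^sup>2 * (norm y)\<^sup>2) \<le>
        pencil A B C ?x ?y * ((norm x)\<^sup>2 * (norm y)\<^sup>2)"
      by (intro mult_right_mono) simp_all
    also have "\<dots> = pencil A B C x y"
      unfolding pencil_scale[OF assms(3-5)] using False by (simp add: power_divide)
    finally show ?thesis .
  qed
  have "a\<^sup>2 + b\<^sup>2 = 1" "w \<in> S" "norm w = 1"
    using p(1) by (simp_all add: pw norm_prod_def)
  with le show ?thesis using that by blast
qed

text \<open>Induction on the dimension. Working in subspaces of one fixed type lets the induction
  pass from \<open>S\<close> to the part of \<open>S\<close> orthogonal to \<open>w\<close>; for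
  this reason \<open>h\<close> has to agree with the pencil only on \<open>S\<close>.\<close>

lemma sos_pencil_on_subspace:
  fixes A B C :: "'b::euclidean_space \<Rightarrow> 'b \<Rightarrow> real"
  assumes "subspace S" "symbilinear A" "symbilinear B" "symbilinear C"
    and "\<And>x y. y \<in> S \<Longrightarrow> 0 \<le> pencil A B C x y"
  shows "\<exists>h. sos h \<and> (\<forall>x. \<forall>y\<in>S. h x y = pencil A B C x y)"
  using assms
proof (induction "dim S" arbitrary: S A B C rule: less_induct)
  case less
  show ?case
  proof (cases "S = {0}")
    case True
    then have "\<forall>x. \<forall>y\<in>S. 0 = pencil A B C x y"
      by (simp add: pencil_def symbilinearD[OF less.prems(2)] symbilinearD[OF less.prems(3)]
          symbilinearD[OF less.prems(4)])
    then show ?thesis using sos_zero by blast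
  next
    case False
    obtain a b w where abw: "a\<^sup>2 + b\<^sup>2 = 1" "w \<in> S" "norm w = 1"
      and min: "\<And>x y. y \<in> S \<Longrightarrow>
        pencil A B C (a, b) w * ((norm x)\<^sup>2 * (norm y)\<^sup>2) \<le> pencil A B C x y"
      using pencil_minimum[OF less.prems(1) False less.prems(2-4)] by blast
    define m where "m = pencil A B C (a, b) w"
    have m0: "0 \<le> m" unfolding m_def by (intro less.prems abw)
    define A1 where "A1 = (\<lambda>y z. A y z - m * (y \<bullet> z))"
    define C1 where "C1 = (\<lambda>y z. C y z - m * (y \<bullet> z))"
    have AC1: "symbilinear A1" "symbilinear C1"
      unfolding A1_def C1_def
      by (intro symbilinear_diff less.prems symbilinear_cmult symbilinear_inner)+
    have pencil1: "pencil A1 B C1 x y = pencil A B C x y - m * ((norm x)\<^sup>2 * (norm y)\<^sup>2)" for x y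
      by (cases x) (simp add: pencil_def A1_def C1_def norm_prod_def power2_norm_eq_inner algebra_simps)
    define A2 where "A2 = (\<lambda>y z. a\<^sup>2 * A1 y z + 2 * a * b * B y z + b\<^sup>2 * C1 y z)"
    define B2 where "B2 = (\<lambda>y z. (a\<^sup>2 - b\<^sup>2) * B y z + a * b * (C1 y z - A1 y z))"
    define C2 where "C2 = (\<lambda>y z. b\<^sup>2 * A1 y z - 2 * a * b * B y z + a\<^sup>2 * C1 y z)"
    note rot = pencil_rotate[OF abw(1), of A1 B C1, folded A2_def B2_def C2_def]
    have sym2: "symbilinear A2" "symbilinear B2" "symbilinear C2"
      unfolding A2_def B2_def C2_def
      by (intro symbilinear_add symbilinear_diff symbilinear_cmult less.prems AC1)+
    have nonneg2: "0 \<le> pencil A2 B2 C2 x y" if "y \<in> S" for x y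
      using min[OF that] by (cases x) (simp add: rot(1)[symmetric] pencil1 m_def)
    have "pencil A2 B2 C2 (1, 0) w = 0"
      unfolding rot(1)[symmetric] using abw by (simp add: pencil1 m_def norm_prod_def)
    then have "A2 w w = 0" by (simp add: pencil_def)
    from pencil_deflate[OF less.prems(1) abw(2,3) sym2 nonneg2 this]
    obtain A' B' C' q where sym': "symbilinear A'" "symbilinear B'" "symbilinear C'" "bilinear q"
      and nonneg': "\<And>x y. y \<in> S \<Longrightarrow> y \<bullet> w = 0 \<Longrightarrow> 0 \<le> pencil A' B' C' x y"
      and split: "\<And>x y. y \<in> S \<Longrightarrow>
        pencil A2 B2 C2 x y = (q x y)\<^sup>2 + pencil A' B' C' x (y - (y \<bullet> w) *\<^sub>R w)"
      by blast
    define S' where "S' = {y \<in> S. y \<bullet> w = 0}"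
    have S': "subspace S'"
      using less.prems(1) unfolding S'_def subspace_def by (simp add: inner_add_left)
    have "w \<notin> S'" using abw by (auto simp: S'_def)
    moreover have "S' \<subseteq> S" by (auto simp: S'_def)
    ultimately have "S' \<subset> S" using abw(2) by blast
    moreover have "span S' = S'" "span S = S"
      using S' less.prems(1) by simp_all
    ultimately have "dim S' < dim S"
      by (metis dim_psubset)
    moreover have "0 \<le> pencil A' B' C' x y" if "y \<in> S'" for x y
      using nonneg' that by (simp add: S'_def)
    ultimately have "\<exists>h. sos h \<and> (\<forall>x. \<forall>y\<in>S'. h x y = pencil A' B' C' x y)"
      using less.hyps[OF _ S' sym'(1-3)] by simp
    then obtain h where h: "sos h" "\<And>x y. y \<in> S' \<Longrightarrow> h x y = pencil A' B' C' x y"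
      by blast
    \<comment> \<open>\<open>R\<close> undoes the rotation and \<pi> projects along
      \<open>w\<close>; composing with them turns the decomposition on \<open>S'\<close> into one on
      \<open>S\<close>.\<close>
    define R where "R = (\<lambda>x. (a * fst x + b * snd x, a * snd x - b * fst x))"
    define \<pi> where "\<pi> = (\<lambda>y. y - (y \<bullet> w) *\<^sub>R w)"
    have R: "linear R" unfolding R_def linear_iff by (simp add: algebra_simps)
    have \<pi>: "linear \<pi>" unfolding \<pi>_def linear_iff by (simp add: inner_add_left algebra_simps)
    let ?h = "\<lambda>x y. ((q (R x) y)\<^sup>2 + h (R x) (\<pi> y)) + m * ((norm x)\<^sup>2 * (norm y)\<^sup>2)"
    have "sos ?h"
      by (intro sos_add sos_scale sos_norm_square m0 sos_compose[OF sos_square[OF sym'(4)] R linear_ident]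
          sos_compose[OF h(1) R \<pi>])
    moreover have "?h x y = pencil A B C x y" if "y \<in> S" for x y
    proof -
      have "\<pi> y \<in> S'"
        using that abw less.prems(1) unfolding S'_def \<pi>_def
        by (simp add: subspace_diff subspace_scale inner_diff_left power2_norm_eq_inner[symmetric])
      then have "?h x y = pencil A2 B2 C2 (R x) y + m * ((norm x)\<^sup>2 * (norm y)\<^sup>2)"
        using split[OF that] h(2) by (simp add: \<pi>_def)
      also have "pencil A2 B2 C2 (R x) y = pencil A1 B C1 x y"
        using rot(2)[of "fst x" "snd x" y] by (simp add: R_def)
      finally show ?thesis by (simp add: pencil1)
    qed
    ultimately show ?thesis by blast
  qed
qed

lemma sos_pencil:
  fixes A B C :: "'b::euclidean_space \<Rightarrow> 'b \<Rightarrow> real"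
  assumes "symbilinear A" "symbilinear B" "symbilinear C" "\<And>x y. 0 \<le> pencil A B C x y"
  shows "sos (pencil A B C)"
proof -
  have "\<exists>h. sos h \<and> (\<forall>x. \<forall>y\<in>UNIV. h x y = pencil A B C x y)"
    by (rule sos_pencil_on_subspace) (simp_all add: assms)
  then obtain h where h: "sos h" "\<forall>x. \<forall>y\<in>UNIV. h x y = pencil A B C x y"
    by (elim exE conjE)
  from h(2) have "h = pencil A B C"
    by (simp add: fun_eq_iff)
  with h(1) show ?thesis by simp
qed

section \<open>Biquadratic forms with singular acoustic tensor\<close>

text \<open>On a line in \<open>y\<close> the pencil is a quadratic polynomial in \<open>e\<close>.
  This extends nonnegativity to the exceptional \<open>y\<close> for which a subtracted square
  cannot be made zero.\<close>

lemma pencil_nonneg_limit: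
  assumes "symbilinear A" "symbilinear B" "symbilinear C"
    and "\<And>e. e \<noteq> 0 \<Longrightarrow> 0 \<le> pencil A B C x (y + e *\<^sub>R z)"
  shows "0 \<le> pencil A B C x y"
proof -
  obtain s u where x: "x = (s, u)" by fastforce
  have "pencil A B C x (y + e *\<^sub>R z) = pencil A B C x y
      + (2 * (s\<^sup>2 * A y z + 2 * s * u * B y z + u\<^sup>2 * C y z)) * e + pencil A B C x z * e\<^sup>2" for e
    unfolding x pencil_def
    by (simp add: symbilinearD[OF assms(1)] symbilinearD[OF assms(2)] symbilinearD[OF assms(3)]
        symbilinear_commute[OF assms(1), of z y] symbilinear_commute[OF assms(2), of z y]
        symbilinear_commute[OF assms(3), of z y] power2_eq_square algebra_simps)
  with assms(4) show ?thesis
    using quadratic_nonneg_at_0 by metis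
qed

text \<open>A basis together with its coordinate functionals. The reconstruction identity makes the
  three vectors span the space, hence form a basis.\<close>

definition coords :: "real^3 \<Rightarrow> real^3 \<Rightarrow> real^3 \<Rightarrow>
    (real^3 \<Rightarrow> real) \<Rightarrow> (real^3 \<Rightarrow> real) \<Rightarrow> (real^3 \<Rightarrow> real) \<Rightarrow> bool" where
  "coords a b c X Y Z \<longleftrightarrow> linear X \<and> linear Y \<and> linear Z \<and>
     (\<forall>v. v = X v *\<^sub>R a + Y v *\<^sub>R b + Z v *\<^sub>R c)"

lemma coordsD:
  assumes "coords a b c X Y Z"
  shows "linear X" "linear Y" "linear Z" "X v *\<^sub>R a + Y v *\<^sub>R b + Z v *\<^sub>R c = v"
  using assms unfolding coords_def by auto

lemma linear_cmult: "linear g \<Longrightarrow> linear (\<lambda>v. r * (g v :: real))"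
  by (simp add: linear_iff algebra_simps)

lemma linear_lincomb:
  "linear g \<Longrightarrow> linear h \<Longrightarrow> linear (\<lambda>v. p * (g v :: real) + q * h v)"
  by (simp add: linear_iff algebra_simps)

lemma coords_permute:
  assumes "coords a b c X Y Z"
  shows "coords a c b X Z Y"
  using assms unfolding coords_def by (simp add: algebra_simps)

text \<open>Basis exchange: if \<open>a $ k\<close> is nonzero, \<open>a\<close> replaces the
  standard vector number \<open>k\<close>. The coefficient of \<open>a\<close> is then
  \<open>v $ k / a $ k\<close>, and the other coordinates are corrected by that multiple of
  \<open>a\<close>.\<close>

lemma coords_exists:
  assumes "a \<noteq> 0"
  obtains b c X Y Z where "coords a b c X Y Z"
proof -
  obtain k where k: "a $ k \<noteq> 0"
    using assms by (auto simp: vec_eq_iff)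
  have lin: "linear (\<lambda>v :: real^3. v $ k / a $ k)" "linear (\<lambda>v :: real^3. v $ i - v $ k / a $ k * a $ i)" for i
    unfolding linear_iff by (simp_all add: add_divide_distrib algebra_simps)
  consider "k = 1" | "k = 2" | "k = 3" using exhaust_3 by blast
  then show thesis
  proof cases
    case 1
    have "coords a (axis 2 1) (axis 3 1) (\<lambda>v. v $ k / a $ k)
        (\<lambda>v. v $ 2 - v $ k / a $ k * a $ 2) (\<lambda>v. v $ 3 - v $ k / a $ k * a $ 3)"
      unfolding coords_def vec_eq_iff forall_3 using k lin by (simp add: 1 axis_def)
    then show ?thesis by (rule that)
  next
    case 2
    have "coords a (axis 1 1) (axis 3 1) (\<lambda>v. v $ k / a $ k)
        (\<lambda>v. v $ 1 - v $ k / a $ k * a $ 1) (\<lambda>v. v $ 3 - v $ k / a $ k * a $ 3)"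
      unfolding coords_def vec_eq_iff forall_3 using k lin by (simp add: 2 axis_def)
    then show ?thesis by (rule that)
  next
    case 3
    have "coords a (axis 1 1) (axis 2 1) (\<lambda>v. v $ k / a $ k)
        (\<lambda>v. v $ 1 - v $ k / a $ k * a $ 1) (\<lambda>v. v $ 2 - v $ k / a $ k * a $ 2)"
      unfolding coords_def vec_eq_iff forall_3 using k lin by (simp add: 3 axis_def)
    then show ?thesis by (rule that)
  qed
qed

lemma linear_Pair: "linear g \<Longrightarrow> linear h \<Longrightarrow> linear (\<lambda>v. (g v, h v))"
  by (simp add: linear_iff)

lemma symbilinear_compose:
  "symbilinear A \<Longrightarrow> linear g \<Longrightarrow> symbilinear (\<lambda>x y. A (g x) (g y))"
  unfolding symbilinear_def bilinear_def linear_iff by simp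

text \<open>The polarization of \<open>f(x \<otimes> y)\<close> in both variables: with
  \<open>y' = y\<close> fixed, it is the bilinear form of the acoustic tensor \<open>T(y)\<close>.
  The symmetric roles of the two pairs allow \<open>x\<close> and \<open>y\<close> to be
  exchanged.\<close>

locale biquadratic =
  fixes \<beta> :: "real^3 \<Rightarrow> real^3 \<Rightarrow> real^3 \<Rightarrow> real^3 \<Rightarrow> real"
  assumes symx: "symbilinear (\<lambda>x x'. \<beta> x x' y y')"
    and symy: "symbilinear (\<lambda>y y'. \<beta> x x' y y')"
    and nonneg: "0 \<le> \<beta> x x y y"
begin

lemmas expand = symbilinearD[OF symx] symbilinearD[OF symy]
lemmas commute_x = symbilinear_commute[OF symx]
lemmas commute_y = symbilinear_commute[OF symy]

lemma swap: "biquadratic (\<lambda>y y' x x'. \<beta> x x' y y')"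
  by unfold_locales (rule symx symy nonneg)+

lemma expand_line_y:
  "\<beta> x x' (t *\<^sub>R d + w) (t *\<^sub>R d + w) = t\<^sup>2 * \<beta> x x' d d + 2 * t * \<beta> x x' d w + \<beta> x x' w w"
  by (simp add: expand commute_y[of x x' w d] power2_eq_square algebra_simps)

lemma expand_coords_x:
  "\<beta> (a *\<^sub>R e + b *\<^sub>R f + c *\<^sub>R g) (a *\<^sub>R e + b *\<^sub>R f + c *\<^sub>R g) y y' =
    a\<^sup>2 * \<beta> e e y y' + 2 * a * b * \<beta> e f y y' + 2 * a * c * \<beta> e g y y'
    + b\<^sup>2 * \<beta> f f y y' + 2 * b * c * \<beta> f g y y' + c\<^sup>2 * \<beta> g g y y'"
  by (simp add: expand commute_x[of f e] commute_x[of g e] commute_x[of g f] power2_eq_square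
      algebra_simps)

lemma expand_pair_y:
  "\<beta> x x' (a *\<^sub>R d + b *\<^sub>R d') (a *\<^sub>R d + b *\<^sub>R d') =
    a\<^sup>2 * \<beta> x x' d d + 2 * a * b * \<beta> x x' d d' + b\<^sup>2 * \<beta> x x' d' d'"
  by (simp add: expand commute_y[of x x' d' d] power2_eq_square algebra_simps)

lemma linear_x: "linear (\<lambda>x'. \<beta> x x' y y')"
  using symbilinear_linear[OF symx] .

lemma isotropic_y:
  assumes "\<beta> x x d d = 0"
  shows "\<beta> x x d w = 0"
  using symbilinear_isotropic[OF symy subspace_UNIV nonneg _ assms] by simp

lemma isotropic_x:
  assumes "\<beta> e e y y = 0"
  shows "\<beta> e x y y = 0"
  using symbilinear_isotropic[OF symx subspace_UNIV nonneg _ assms] by simp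

text \<open>By isotropy all mixed terms with \<open>e\<close> vanish too, so the form depends on
  \<open>x\<close> only modulo \<open>e\<close>, a two-dimensional variable.\<close>

lemma sos_kernel:
  assumes "e \<noteq> 0" "\<And>y. \<beta> e e y y = 0"
  shows "sos (\<lambda>x y. \<beta> x x y y)"
proof -
  obtain a b X Y Z where co: "coords e a b X Y Z"
    using coords_exists[OF assms(1)] .
  have eq: "\<beta> (p *\<^sub>R e + s *\<^sub>R a + u *\<^sub>R b) (p *\<^sub>R e + s *\<^sub>R a + u *\<^sub>R b) y y =
      pencil (\<beta> a a) (\<beta> a b) (\<beta> b b) (s, u) y" for p s u y
    unfolding expand_coords_x by (simp add: assms(2) isotropic_x pencil_def)
  have "0 \<le> pencil (\<beta> a a) (\<beta> a b) (\<beta> b b) x y" for x y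
    using nonneg eq[of 0 "fst x" "snd x" y] by (metis prod.collapse)
  then have "sos (pencil (\<beta> a a) (\<beta> a b) (\<beta> b b))"
    by (intro sos_pencil symy)
  then have "sos (\<lambda>x y. pencil (\<beta> a a) (\<beta> a b) (\<beta> b b) (Y x, Z x) y)"
    by (rule sos_compose) (intro linear_Pair coordsD[OF co] linear_ident)+
  moreover have "\<beta> x x y y = pencil (\<beta> a a) (\<beta> a b) (\<beta> b b) (Y x, Z x) y" for x y
    using eq[of "X x" "Y x" "Z x" y] by (simp add: coordsD[OF co])
  ultimately show ?thesis by simp
qed

text \<open>On the kernel of \<open>l\<close> the vector \<open>d\<close> is isotropic, so the mixed
  term \<open>\<beta> x x d w\<close> is divisible by \<open>l x\<close>, with quotient
  \<open>h x w\<close>. For \<open>y = t d + w\<close> the square of \<open>l x * t + h x w\<close>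
  splits off, and the remainder involves only the two-dimensional \<open>w\<close>.\<close>

lemma sos_rank_one:
  assumes lin: "linear l" and sq: "\<And>x. \<beta> x x d d = (l x)\<^sup>2" and ne: "l v \<noteq> 0"
  shows "sos (\<lambda>x y. \<beta> x x y y)"
proof -
  define e where "e = (1 / l v) *\<^sub>R v"
  have le: "l e = 1"
    using ne linear_scale[OF lin, of "1 / l v" v] by (simp add: e_def)
  have "d \<noteq> 0"
    using sq[of e] le by (auto simp: expand)
  then obtain w1 w2 T S U where co: "coords d w1 w2 T S U"
    using coords_exists by blast
  \<comment> \<open>The formula comes from solving \<open>\<beta> z z d w = 0\<close> with
    \<open>z = x - l x e\<close> for \<open>\<beta> x x d w\<close>.\<close>
  define h where "h = (\<lambda>x w. 2 * \<beta> e x d w - l x * \<beta> e e d w)"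
  have linh: "linear (\<lambda>x. h x w)" for w
    using linear_x lin unfolding h_def linear_iff by (simp add: algebra_simps)
  have hadd: "h x (s *\<^sub>R w1 + u *\<^sub>R w2) = s * h x w1 + u * h x w2" for x s u
    by (simp add: h_def expand algebra_simps)
  have cross: "\<beta> x x d w = l x * h x w" for x w
  proof -
    define z where "z = x - l x *\<^sub>R e"
    have "l z = 0"
      using le by (simp add: z_def linear_diff[OF lin] linear_scale[OF lin])
    then have "\<beta> z z d d = 0" by (simp add: sq)
    then have "\<beta> z z d w = 0" by (rule isotropic_y)
    then show ?thesis
      by (simp add: z_def h_def expand commute_x[of x e] algebra_simps)
  qed
  define A where "A = (\<lambda>x x'. \<beta> x x' w1 w1 - h x w1 * h x' w1)"
  define B where "B = (\<lambda>x x'. \<beta> x x' w1 w2 - (1/2) * (h x w1 * h x' w2 + h x' w1 * h x w2))"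
  define C where "C = (\<lambda>x x'. \<beta> x x' w2 w2 - h x w2 * h x' w2)"
  have sym: "symbilinear A" "symbilinear B" "symbilinear C"
    unfolding A_def B_def C_def
    by (intro symbilinear_diff symx symbilinear_mult_self symbilinear_cmult symbilinear_mult linh)+
  have split: "\<beta> x x (t *\<^sub>R d + s *\<^sub>R w1 + u *\<^sub>R w2) (t *\<^sub>R d + s *\<^sub>R w1 + u *\<^sub>R w2) =
      (l x * t + (h x w1 * s + h x w2 * u))\<^sup>2 + pencil A B C (s, u) x" for x t s u
  proof -
    have "t *\<^sub>R d + s *\<^sub>R w1 + u *\<^sub>R w2 = t *\<^sub>R d + (s *\<^sub>R w1 + u *\<^sub>R w2)"
      by simp
    then show ?thesis
      using expand_line_y[of x x t d "s *\<^sub>R w1 + u *\<^sub>R w2"]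
      unfolding sq cross[of x "s *\<^sub>R w1 + u *\<^sub>R w2"] hadd expand_pair_y[of x x s w1 u w2]
      by (simp add: pencil_def A_def B_def C_def power2_eq_square algebra_simps)
  qed
  \<comment> \<open>The multiple of \<open>d\<close> is chosen to make the square vanish.\<close>
  have nn: "0 \<le> pencil A B C (s, u) x" if "l x \<noteq> 0" for s u x
    using nonneg[of x "(- (h x w1 * s + h x w2 * u) / l x) *\<^sub>R d + s *\<^sub>R w1 + u *\<^sub>R w2"] that
    unfolding split by simp
  have "0 \<le> pencil A B C p x" for p x
  proof (cases "l x = 0")
    case True
    show ?thesis
    \<comment> \<open>Moving from \<open>x\<close> in the direction \<open>e\<close> leaves the
      kernel of \<open>l\<close>.\<close>
    proof (rule pencil_nonneg_limit[OF sym])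
      fix r :: real assume "r \<noteq> 0"
      then have "l (x + r *\<^sub>R e) \<noteq> 0"
        using True le by (simp add: linear_add[OF lin] linear_scale[OF lin])
      then show "0 \<le> pencil A B C p (x + r *\<^sub>R e)"
        using nn by (metis prod.collapse)
    qed
  next
    case False
    then show ?thesis using nn by (metis prod.collapse)
  qed
  from sos_swap[OF sos_pencil[OF sym this]]
  have "sos (\<lambda>x y. pencil A B C (S y, U y) x)"
    by (rule sos_compose) (intro linear_Pair coordsD[OF co] linear_ident)+
  moreover have "bilinear (\<lambda>x y. l x * T y + (h x w1 * S y + h x w2 * U y))"
    by (intro bilinear_add bilinear_mult_linear coordsD[OF co] lin linh)
  ultimately have "sos (\<lambda>x y. (l x * T y + (h x w1 * S y + h x w2 * U y))\<^sup>2 + pencil A B C (S y, U y) x)"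
    by (intro sos_add sos_square)
  moreover have "\<beta> x x y y = (l x * T y + (h x w1 * S y + h x w2 * U y))\<^sup>2 + pencil A B C (S y, U y) x"
    for x y
    using split[of x "T y" "S y" "U y"] by (simp add: coordsD[OF co])
  ultimately show ?thesis by simp
qed

end

section \<open>Polynomial identities forced by a vanishing determinant\<close>

lemma quartic_zero_top:
  fixes a b c d e :: real
  assumes "\<And>t. a * t^4 + b * t^3 + c * t^2 + d * t + e = 0"
  shows "a = 0" "b = 0"
proof -
  have "a = 0 \<and> b = 0"
    using assms[of 0] assms[of 1] assms[of "-1"] assms[of 2] assms[of "-2"] by simp
  then show "a = 0" "b = 0" by simp_all
qed

lemma cubic_form_zero:
  fixes a b c d :: real
  assumes "\<And>x y. a * x^3 + b * x^2 * y + c * x * y^2 + d * y^3 = 0"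
  shows "a = 0" "b = 0" "c = 0" "d = 0"
proof -
  have "a = 0 \<and> b = 0 \<and> c = 0 \<and> d = 0"
    using assms[of 1 0] assms[of 0 1] assms[of 1 1] assms[of 1 "-1"] by simp
  then show "a = 0" "b = 0" "c = 0" "d = 0" by simp_all
qed

text \<open>The conclusion says that the symmetric matrix has determinant zero. Multiplying its
  kernel equations by the adjugate shows that each \<open>xi\<close> times the determinant
  vanishes.\<close>

lemma singular_sym_3:
  fixes g11 :: real
  assumes "x1 * g11 + x2 * g12 + x3 * g13 = 0"
    "x1 * g12 + x2 * g22 + x3 * g23 = 0"
    "x1 * g13 + x2 * g23 + x3 * g33 = 0"
    "\<not> (x1 = 0 \<and> x2 = 0 \<and> x3 = 0)"
  shows "g11 * (g22 * g33 - g23\<^sup>2) = g12\<^sup>2 * g33 - 2 * g12 * g13 * g23 + g13\<^sup>2 * g22"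
proof -
  let ?D = "g11 * (g22 * g33 - g23\<^sup>2) - (g12\<^sup>2 * g33 - 2 * g12 * g13 * g23 + g13\<^sup>2 * g22)"
  have "x1 * ?D = 0" "x2 * ?D = 0" "x3 * ?D = 0"
    using assms(1-3) by algebra+
  then have "?D = 0" using assms(4) by (metis mult_eq_0_iff)
  then show ?thesis by simp
qed

text \<open>
  The hypothesis is \<open>det T(t d + w) = 0\<close> when \<open>T(d) = diag(0, 1, 1)\<close>; the conclusions are its
  coefficients of \<open>t\<^sup>4\<close> and \<open>t\<^sup>3\<close>.
\<close>

lemma det_line_leading:
  fixes A :: real
  assumes "\<And>t. A * ((t\<^sup>2 + 2 * t * p22 + n22) * (t\<^sup>2 + 2 * t * p33 + n33) - (2 * t * p23 + n23)\<^sup>2) =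
     (t * l2 + b2)\<^sup>2 * (t\<^sup>2 + 2 * t * p33 + n33) - 2 * (t * l2 + b2) * (t * l3 + b3) * (2 * t * p23 + n23)
     + (t * l3 + b3)\<^sup>2 * (t\<^sup>2 + 2 * t * p22 + n22)"
  shows "A = l2\<^sup>2 + l3\<^sup>2" "l2 * b2 + l3 * b3 = l2\<^sup>2 * p22 + 2 * l2 * l3 * p23 + l3\<^sup>2 * p33"
proof -
  \<comment> \<open>The lower coefficients of the difference of the two sides, a polynomial of
    degree four in \<open>t\<close>.\<close>
  define c0 c1 c2 where "c0 = A * (n22 * n33 - n23\<^sup>2) - b2\<^sup>2 * n33 + 2 * b2 * b3 * n23 - b3\<^sup>2 * n22"
    and "c1 = A * (2 * p22 * n33 + 2 * p33 * n22 - 4 * p23 * n23) - (2 * l2 * b2 * n33 + 2 * b2\<^sup>2 * p33)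
      + 2 * (l2 * b3 + l3 * b2) * n23 + 4 * b2 * b3 * p23 - (2 * l3 * b3 * n22 + 2 * b3\<^sup>2 * p22)"
    and "c2 = A * (n22 + n33 + 4 * p22 * p33 - 4 * p23\<^sup>2) - (b2\<^sup>2 + 4 * l2 * b2 * p33 + l2\<^sup>2 * n33)
      + 2 * l2 * l3 * n23 + 4 * (l2 * b3 + l3 * b2) * p23 - (b3\<^sup>2 + 4 * l3 * b3 * p22 + l3\<^sup>2 * n22)"
  have "(A - l2\<^sup>2 - l3\<^sup>2) * t^4 + (A * (2 * p22 + 2 * p33) - 2 * l2 * b2 - 2 * l2\<^sup>2 * p33 + 4 * l2 * l3 * p23
      - 2 * l3 * b3 - 2 * l3\<^sup>2 * p22) * t^3 + c2 * t^2 + c1 * t + c0 = 0" for t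
    using assms[of t] unfolding c0_def c1_def c2_def by algebra
  note * = quartic_zero_top[OF this]
  then show A: "A = l2\<^sup>2 + l3\<^sup>2" by simp
  from *(2) show "l2 * b2 + l3 * b3 = l2\<^sup>2 * p22 + 2 * l2 * l3 * p23 + l3\<^sup>2 * p33"
    unfolding A by (simp add: algebra_simps)
qed

section \<open>Acoustic tensors of rank two and the general singular case\<close>

context biquadratic
begin

text \<open>With \<open>w = (a, b)\<close> and \<open>P\<close> the matrix of mixed terms in
  \<open>e2\<close>, \<open>e3\<close>, hypothesis \<open>lB\<close> says that the vector
  \<open>(\<beta> e1 e2 w w, \<beta> e1 e3 w w)\<close> minus \<open>P w\<close> is orthogonal to
  \<open>w\<close>. In the plane it is therefore \<open>s(w) (b, -a)\<close> with \<open>s\<close>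
  linear. This antisymmetric correction enters the two squares \<open>b2\<close> and
  \<open>b3\<close>.\<close>

lemma sos_normal_form:
  assumes cx: "coords e1 e2 e3 X1 X2 X3" and cy: "coords d1 d2 d3 Y1 Y2 Y3"
    and T: "\<beta> e1 e1 d1 d1 = 0" "\<beta> e2 e2 d1 d1 = 1" "\<beta> e2 e3 d1 d1 = 0" "\<beta> e3 e3 d1 d1 = 1"
    and l2: "\<And>a b. 2 * \<beta> e1 e2 d1 (a *\<^sub>R d2 + b *\<^sub>R d3) = a"
    and l3: "\<And>a b. 2 * \<beta> e1 e3 d1 (a *\<^sub>R d2 + b *\<^sub>R d3) = b"
    and ll: "\<And>a b. \<beta> e1 e1 (a *\<^sub>R d2 + b *\<^sub>R d3) (a *\<^sub>R d2 + b *\<^sub>R d3) = a\<^sup>2 + b\<^sup>2"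
    and lB: "\<And>a b w. w = a *\<^sub>R d2 + b *\<^sub>R d3 \<Longrightarrow> a * \<beta> e1 e2 w w + b * \<beta> e1 e3 w w =
      a\<^sup>2 * \<beta> e2 e2 d1 w + 2 * a * b * \<beta> e2 e3 d1 w + b\<^sup>2 * \<beta> e3 e3 d1 w"
  shows "sos (\<lambda>x y. \<beta> x x y y)"
proof -
  define W :: "real \<times> real \<Rightarrow> real^3" where "W = (\<lambda>v. fst v *\<^sub>R d2 + snd v *\<^sub>R d3)"
  define p where "p = (\<lambda>z z' v. \<beta> z z' d1 (W v))"
  \<comment> \<open>The coefficients of \<open>s\<close>, read off from the terms in
    \<open>a b\<close> and \<open>b^2\<close> of \<open>\<beta> e1 e2 w w\<close>.\<close>
  define q1 where "q1 = 2 * \<beta> e1 e2 d2 d3 - \<beta> e2 e2 d1 d3 - \<beta> e2 e3 d1 d2"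
  define q2 where "q2 = \<beta> e1 e2 d3 d3 - \<beta> e2 e3 d1 d3"
  define s :: "real \<times> real \<Rightarrow> real" where "s = (\<lambda>v. q1 * fst v + q2 * snd v)"
  have W: "linear W"
    unfolding W_def linear_iff by (simp add: algebra_simps)
  have linp: "linear (p z z')" for z z'
    using symbilinear_linear[OF symy] W unfolding p_def linear_iff by simp
  have lins: "linear s"
    unfolding s_def by (intro linear_lincomb linear_fst linear_snd)
  \<comment> \<open>Written out, \<open>lB\<close> is a binary cubic form that vanishes identically,
    so its four coefficients are zero.\<close>
  have cubic:
    "(\<beta> e1 e2 d2 d2 - \<beta> e2 e2 d1 d2) * a^3
      + (2 * \<beta> e1 e2 d2 d3 + \<beta> e1 e3 d2 d2 - \<beta> e2 e2 d1 d3 - 2 * \<beta> e2 e3 d1 d2) * a^2 * b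
      + (\<beta> e1 e2 d3 d3 + 2 * \<beta> e1 e3 d2 d3 - 2 * \<beta> e2 e3 d1 d3 - \<beta> e3 e3 d1 d2) * a * b^2
      + (\<beta> e1 e3 d3 d3 - \<beta> e3 e3 d1 d3) * b^3 = 0" for a b
    using lB[OF refl, of a b] unfolding expand_pair_y
    by (simp add: expand power2_eq_square power3_eq_cube algebra_simps)
  note cubic = cubic_form_zero[OF cubic]
  have B2: "\<beta> e1 e2 (W v) (W v) = fst v * p e2 e2 v + snd v * p e2 e3 v + s v * snd v" for v
    using cubic unfolding W_def expand_pair_y p_def s_def q1_def q2_def
    by (simp add: expand power2_eq_square algebra_simps)
  have B3: "\<beta> e1 e3 (W v) (W v) = fst v * p e2 e3 v + snd v * p e3 e3 v - s v * fst v" for v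
  proof -
    have eqs: "\<beta> e1 e3 d2 d2 = \<beta> e2 e3 d1 d2 - q1" "2 * \<beta> e1 e3 d2 d3 = \<beta> e2 e3 d1 d3 + \<beta> e3 e3 d1 d2 - q2"
      "\<beta> e1 e3 d3 d3 = \<beta> e3 e3 d1 d3"
      using cubic unfolding q1_def q2_def by linarith+
    have "(fst v)\<^sup>2 * \<beta> e1 e3 d2 d2 + fst v * snd v * (2 * \<beta> e1 e3 d2 d3) + (snd v)\<^sup>2 * \<beta> e1 e3 d3 d3
      = fst v * p e2 e3 v + snd v * p e3 e3 v - s v * fst v"
      unfolding eqs p_def s_def W_def by (simp add: expand power2_eq_square algebra_simps)
    then show ?thesis unfolding W_def expand_pair_y by simp
  qed
  \<comment> \<open>What remains of the block in \<open>e2\<close>, \<open>e3\<close> after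
    subtracting the squares of the rows \<open>(p22, p23 - s)\<close> and
    \<open>(p23 + s, p33)\<close>.\<close>
  define A where "A = (\<lambda>v v'. \<beta> e2 e2 (W v) (W v') - p e2 e2 v * p e2 e2 v'
    - (p e2 e3 v + s v) * (p e2 e3 v' + s v'))"
  define B where "B = (\<lambda>v v'. \<beta> e2 e3 (W v) (W v')
    - (1/2) * (p e2 e2 v * (p e2 e3 v' - s v') + p e2 e2 v' * (p e2 e3 v - s v))
    - (1/2) * ((p e2 e3 v + s v) * p e3 e3 v' + (p e2 e3 v' + s v') * p e3 e3 v))"
  define C where "C = (\<lambda>v v'. \<beta> e3 e3 (W v) (W v') - (p e2 e3 v - s v) * (p e2 e3 v' - s v')
    - p e3 e3 v * p e3 e3 v')"
  have linps: "linear (\<lambda>v. p e2 e3 v + s v)" "linear (\<lambda>v. p e2 e3 v - s v)"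
    using linp lins by (simp_all add: linear_compose_add linear_compose_sub)
  have sym: "symbilinear A" "symbilinear B" "symbilinear C"
    unfolding A_def B_def C_def
    by (intro symbilinear_diff symbilinear_compose[OF symy W] symbilinear_mult_self symbilinear_cmult
        symbilinear_mult linp linps)+
  define b2 where "b2 = (\<lambda>x1 x2 x3 t v. x2 * t + x1 * fst v + (x2 * p e2 e2 v + x3 * (p e2 e3 v - s v)))"
  define b3 where "b3 = (\<lambda>x1 x2 x3 t v. x3 * t + x1 * snd v + (x2 * (p e2 e3 v + s v) + x3 * p e3 e3 v))"
  have split: "\<beta> (x1 *\<^sub>R e1 + x2 *\<^sub>R e2 + x3 *\<^sub>R e3) (x1 *\<^sub>R e1 + x2 *\<^sub>R e2 + x3 *\<^sub>R e3)
      (t *\<^sub>R d1 + W v) (t *\<^sub>R d1 + W v) =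
      (b2 x1 x2 x3 t v)\<^sup>2 + (b3 x1 x2 x3 t v)\<^sup>2 + pencil A B C (x2, x3) v" for x1 x2 x3 t v
  proof -
    have "\<beta> e1 e1 (W v) (W v) = (fst v)\<^sup>2 + (snd v)\<^sup>2"
      "\<beta> e1 e2 d1 (W v) = fst v / 2" "\<beta> e1 e3 d1 (W v) = snd v / 2"
      using ll l2[of "fst v" "snd v"] l3[of "fst v" "snd v"] unfolding W_def by simp_all
    then have lines: "\<beta> e1 e1 (t *\<^sub>R d1 + W v) (t *\<^sub>R d1 + W v) = (fst v)\<^sup>2 + (snd v)\<^sup>2"
      "\<beta> e1 e2 (t *\<^sub>R d1 + W v) (t *\<^sub>R d1 + W v) = t * fst v + \<beta> e1 e2 (W v) (W v)"
      "\<beta> e1 e3 (t *\<^sub>R d1 + W v) (t *\<^sub>R d1 + W v) = t * snd v + \<beta> e1 e3 (W v) (W v)"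
      "\<beta> e2 e2 (t *\<^sub>R d1 + W v) (t *\<^sub>R d1 + W v) = t\<^sup>2 + 2 * t * p e2 e2 v + \<beta> e2 e2 (W v) (W v)"
      "\<beta> e2 e3 (t *\<^sub>R d1 + W v) (t *\<^sub>R d1 + W v) = 2 * t * p e2 e3 v + \<beta> e2 e3 (W v) (W v)"
      "\<beta> e3 e3 (t *\<^sub>R d1 + W v) (t *\<^sub>R d1 + W v) = t\<^sup>2 + 2 * t * p e3 e3 v + \<beta> e3 e3 (W v) (W v)"
      unfolding expand_line_y[of _ _ t d1 "W v"]
      by (simp_all add: T isotropic_x[OF T(1)] isotropic_y[OF T(1)] p_def)
    show ?thesis
      unfolding expand_coords_x lines B2 B3
      by (simp add: pencil_def A_def B_def C_def b2_def b3_def power2_eq_square algebra_simps)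
  qed
  have nn: "0 \<le> pencil A B C (x2, x3) v" if D: "x2 * snd v - x3 * fst v \<noteq> 0" for x2 x3 v
  proof -
    define k2 where "k2 = x2 * p e2 e2 v + x3 * (p e2 e3 v - s v)"
    define k3 where "k3 = x2 * (p e2 e3 v + s v) + x3 * p e3 e3 v"
    \<comment> \<open>Cramer's rule for the linear system \<open>b2 = b3 = 0\<close> in the unknowns
      \<open>t\<close> and \<open>x1\<close>.\<close>
    define t where "t = (k3 * fst v - k2 * snd v) / (x2 * snd v - x3 * fst v)"
    define x1 where "x1 = (x3 * k2 - x2 * k3) / (x2 * snd v - x3 * fst v)"
    have "b2 x1 x2 x3 t v = 0" "b3 x1 x2 x3 t v = 0"
      unfolding b2_def b3_def k2_def[symmetric] k3_def[symmetric] t_def x1_def using D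
      by (simp_all add: divide_simps) (simp_all add: algebra_simps)
    then show ?thesis
      using split[of x1 x2 x3 t v] nonneg by (metis add_0 power_zero_numeral)
  qed
  have nonneg_pencil: "0 \<le> pencil A B C x v" for x v
  proof -
    obtain x2 x3 where x: "x = (x2, x3)" by fastforce
    show ?thesis
    proof (cases "x = 0")
      case True
      then show ?thesis by (simp add: pencil_def case_prod_beta)
    next
      case False
      then have pos: "x2\<^sup>2 + x3\<^sup>2 \<noteq> 0"
        by (simp add: x zero_prod_def sum_power2_eq_zero_iff)
      show ?thesis
      proof (cases "x2 * snd v - x3 * fst v = 0")
        case True
        show ?thesis
        proof (rule pencil_nonneg_limit[OF sym])
          fix r :: real assume "r \<noteq> 0"
          \<comment> \<open>Moving along the quarter turn of \<open>(x2, x3)\<close> changes the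
            determinant at rate \<open>x2^2 + x3^2\<close>, which is nonzero.\<close>
          let ?v = "v + r *\<^sub>R (- x3, x2)"
          have "x2 * snd ?v - x3 * fst ?v = (x2 * snd v - x3 * fst v) + r * (x2\<^sup>2 + x3\<^sup>2)"
            by (simp add: power2_eq_square algebra_simps)
          then have "x2 * snd ?v - x3 * fst ?v \<noteq> 0"
            using True pos \<open>r \<noteq> 0\<close> by simp
          from nn[OF this] show "0 \<le> pencil A B C x ?v" by (simp only: x)
        qed
      qed (use nn x in simp)
    qed
  qed
  from sos_pencil[OF sym this]
  have rest: "sos (\<lambda>x y. pencil A B C (X2 x, X3 x) (Y2 y, Y3 y))"
    by (rule sos_compose) (intro linear_Pair coordsD[OF cx] coordsD[OF cy])+
  have comp: "linear (\<lambda>y. g (Y2 y, Y3 y))" if "linear g" for g :: "real \<times> real \<Rightarrow> real"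
    using linear_compose[OF linear_Pair[OF coordsD(2,3)[OF cy]] that] by (simp add: o_def)
  have "bilinear (\<lambda>x y. b2 (X1 x) (X2 x) (X3 x) (Y1 y) (Y2 y, Y3 y))"
    "bilinear (\<lambda>x y. b3 (X1 x) (X2 x) (X3 x) (Y1 y) (Y2 y, Y3 y))"
    unfolding b2_def b3_def
    by (intro bilinear_add bilinear_mult_linear coordsD[OF cx] coordsD[OF cy] comp[OF linear_fst]
        comp[OF linear_snd] comp[OF linp] comp[OF linps(1)] comp[OF linps(2)])+
  with rest have "sos (\<lambda>x y. (b2 (X1 x) (X2 x) (X3 x) (Y1 y) (Y2 y, Y3 y))\<^sup>2
      + (b3 (X1 x) (X2 x) (X3 x) (Y1 y) (Y2 y, Y3 y))\<^sup>2
      + pencil A B C (X2 x, X3 x) (Y2 y, Y3 y))"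
    by (intro sos_add sos_square)
  moreover have "\<beta> x x y y = (b2 (X1 x) (X2 x) (X3 x) (Y1 y) (Y2 y, Y3 y))\<^sup>2
      + (b3 (X1 x) (X2 x) (X3 x) (Y1 y) (Y2 y, Y3 y))\<^sup>2
      + pencil A B C (X2 x, X3 x) (Y2 y, Y3 y)" for x y
    using split[of "X1 x" "X2 x" "X3 x" "Y1 y" "(Y2 y, Y3 y)"]
    by (simp add: W_def coordsD(4)[OF cx] coordsD(4)[OF cy] add.assoc[symmetric])
  ultimately show ?thesis by simp
qed

text \<open>The leading coefficients in \<open>t\<close> of the determinant on the line
  \<open>t d + w\<close> give \<open>\<beta> e1 e1 w w = (l2 w)^2 + (l3 w)^2\<close> and the
  relation \<open>lB\<close>. The proof then splits according to the rank of
  \<open>(l2, l3)\<close>.\<close>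

lemma sos_rank_two:
  assumes sing: "\<And>y. \<exists>x. x \<noteq> 0 \<and> (\<forall>z. \<beta> x z y y = 0)"
    and e1: "e1 \<noteq> 0" and cx: "coords e1 e2 e3 X1 X2 X3"
    and T: "\<beta> e1 e1 d d = 0" "\<beta> e2 e2 d d = 1" "\<beta> e2 e3 d d = 0" "\<beta> e3 e3 d d = 1"
  shows "sos (\<lambda>x y. \<beta> x x y y)"
proof (cases "\<forall>y. \<beta> e1 e1 y y = 0")
  case True
  then show ?thesis using sos_kernel[OF e1] by blast
next
  case False
  have gram: "\<beta> e1 e1 y y * (\<beta> e2 e2 y y * \<beta> e3 e3 y y - (\<beta> e2 e3 y y)\<^sup>2) =
      (\<beta> e1 e2 y y)\<^sup>2 * \<beta> e3 e3 y y - 2 * \<beta> e1 e2 y y * \<beta> e1 e3 y y * \<beta> e2 e3 y y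
      + (\<beta> e1 e3 y y)\<^sup>2 * \<beta> e2 e2 y y" for y
  proof -
    obtain x where x: "x \<noteq> 0" "\<And>z. \<beta> x z y y = 0" using sing by blast
    have eq: "X1 x * \<beta> e1 z y y + X2 x * \<beta> e2 z y y + X3 x * \<beta> e3 z y y = 0" for z
    proof -
      have "\<beta> (X1 x *\<^sub>R e1 + X2 x *\<^sub>R e2 + X3 x *\<^sub>R e3) z y y = 0"
        unfolding coordsD(4)[OF cx] by (rule x)
      then show ?thesis by (simp add: expand)
    qed
    show ?thesis
    proof (rule singular_sym_3)
      show "\<not> (X1 x = 0 \<and> X2 x = 0 \<and> X3 x = 0)"
        using coordsD(4)[OF cx, of x] x(1) by auto
    qed (use eq[of e1] eq[of e2] eq[of e3] in
        \<open>simp_all add: commute_x[of e2 e1] commute_x[of e3 e1] commute_x[of e3 e2]\<close>)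
  qed
  have lines: "\<beta> e1 e1 (t *\<^sub>R d + w) (t *\<^sub>R d + w) = \<beta> e1 e1 w w"
    "\<beta> e1 e2 (t *\<^sub>R d + w) (t *\<^sub>R d + w) = t * (2 * \<beta> e1 e2 d w) + \<beta> e1 e2 w w"
    "\<beta> e1 e3 (t *\<^sub>R d + w) (t *\<^sub>R d + w) = t * (2 * \<beta> e1 e3 d w) + \<beta> e1 e3 w w"
    "\<beta> e2 e2 (t *\<^sub>R d + w) (t *\<^sub>R d + w) = t\<^sup>2 + 2 * t * \<beta> e2 e2 d w + \<beta> e2 e2 w w"
    "\<beta> e2 e3 (t *\<^sub>R d + w) (t *\<^sub>R d + w) = 2 * t * \<beta> e2 e3 d w + \<beta> e2 e3 w w"
    "\<beta> e3 e3 (t *\<^sub>R d + w) (t *\<^sub>R d + w) = t\<^sup>2 + 2 * t * \<beta> e3 e3 d w + \<beta> e3 e3 w w" for t w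
    unfolding expand_line_y[of _ _ t d w]
    by (simp_all add: T isotropic_x[OF T(1)] isotropic_y[OF T(1)])
  define l2 where "l2 = (\<lambda>w. 2 * \<beta> e1 e2 d w)"
  define l3 where "l3 = (\<lambda>w. 2 * \<beta> e1 e3 d w)"
  have lin: "linear l2" "linear l3"
    unfolding l2_def l3_def using symbilinear_linear[OF symy] by (simp_all add: linear_cmult)
  have det: "\<beta> e1 e1 w w * ((t\<^sup>2 + 2 * t * \<beta> e2 e2 d w + \<beta> e2 e2 w w)
        * (t\<^sup>2 + 2 * t * \<beta> e3 e3 d w + \<beta> e3 e3 w w) - (2 * t * \<beta> e2 e3 d w + \<beta> e2 e3 w w)\<^sup>2) =
      (t * l2 w + \<beta> e1 e2 w w)\<^sup>2 * (t\<^sup>2 + 2 * t * \<beta> e3 e3 d w + \<beta> e3 e3 w w)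
      - 2 * (t * l2 w + \<beta> e1 e2 w w) * (t * l3 w + \<beta> e1 e3 w w) * (2 * t * \<beta> e2 e3 d w + \<beta> e2 e3 w w)
      + (t * l3 w + \<beta> e1 e3 w w)\<^sup>2 * (t\<^sup>2 + 2 * t * \<beta> e2 e2 d w + \<beta> e2 e2 w w)" for t w
    using gram[of "t *\<^sub>R d + w"] unfolding lines l2_def l3_def .
  note leading = det_line_leading[OF det]
  have ll: "\<beta> e1 e1 w w = (l2 w)\<^sup>2 + (l3 w)\<^sup>2" for w
    by (rule leading)
  have lB: "l2 w * \<beta> e1 e2 w w + l3 w * \<beta> e1 e3 w w =
      (l2 w)\<^sup>2 * \<beta> e2 e2 d w + 2 * l2 w * l3 w * \<beta> e2 e3 d w + (l3 w)\<^sup>2 * \<beta> e3 e3 d w" for w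
    by (rule leading)
  \<comment> \<open>If \<open>f(e1 \<otimes> y)\<close> is a single square, then with the variables
    exchanged \<open>e1\<close> plays the part of \<open>d\<close> in
    \<open>sos_rank_one\<close>.\<close>
  have rank_one: ?thesis if l: "linear l" "\<And>w. \<beta> e1 e1 w w = (l w)\<^sup>2" for l
  proof -
    obtain v where "l v \<noteq> 0" using False l(2) by auto
    from sos_swap[OF biquadratic.sos_rank_one[OF swap l this]] show ?thesis .
  qed
  have "d \<noteq> 0" using T(2) by (auto simp: expand)
  then obtain w2 w3 Y1 Y2 Y3 where cy: "coords d w2 w3 Y1 Y2 Y3"
    using coords_exists by blast
  have ld: "l2 d = 0" "l3 d = 0"
    unfolding l2_def l3_def by (simp_all add: isotropic_x[OF T(1)])
  have l_eq: "l w = Y2 w * l w2 + Y3 w * l w3" if "linear l" "l d = 0" for l :: "real^3 \<Rightarrow> real" and w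
  proof -
    have "l w = l (Y1 w *\<^sub>R d + Y2 w *\<^sub>R w2 + Y3 w *\<^sub>R w3)"
      by (simp add: coordsD(4)[OF cy])
    then show ?thesis by (simp add: linear_add[OF that(1)] linear_scale[OF that(1)] that(2))
  qed
  \<comment> \<open>Since both functionals vanish at \<open>d\<close>, this determinant decides
    whether they are linearly independent.\<close>
  define D where "D = l2 w2 * l3 w3 - l2 w3 * l3 w2"
  show ?thesis
  proof (cases "D = 0")
    case True
    show ?thesis
    proof (cases "l2 w2 = 0 \<and> l2 w3 = 0")
      case True
      then have "l2 w = 0" for w using l_eq[OF lin(1) ld(1), of w] by simp
      then show ?thesis using rank_one[OF lin(2)] ll by simp
    next
      case False
      have "\<exists>k. l3 w2 = k * l2 w2 \<and> l3 w3 = k * l2 w3"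
      proof (cases "l2 w2 = 0")
        case True
        then show ?thesis
          using False \<open>D = 0\<close> by (intro exI[of _ "l3 w3 / l2 w3"]) (auto simp: D_def)
      next
        case False
        then show ?thesis
          using \<open>D = 0\<close> by (intro exI[of _ "l3 w2 / l2 w2"]) (auto simp: D_def field_simps)
      qed
      then obtain k where "l3 w2 = k * l2 w2" "l3 w3 = k * l2 w3" by blast
      then have "l3 w = k * l2 w" for w
        using l_eq[OF lin(1) ld(1), of w] l_eq[OF lin(2) ld(2), of w] by (simp add: algebra_simps)
      then have "\<beta> e1 e1 w w = (sqrt (1 + k\<^sup>2) * l2 w)\<^sup>2" for w
        unfolding ll by (simp add: power_mult_distrib algebra_simps)
      then show ?thesis by (intro rank_one[of "\<lambda>w. sqrt (1 + k\<^sup>2) * l2 w"] linear_cmult lin)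
    qed
  next
    case False
    \<comment> \<open>The basis of the span of \<open>w2\<close>, \<open>w3\<close> dual to
      \<open>l2\<close>, \<open>l3\<close>, by Cramer's rule. The functionals thereby become the
      last two coordinates, and the coordinate along \<open>d\<close> stays
      \<open>Y1\<close>.\<close>
    define d2 where "d2 = (l3 w3 / D) *\<^sub>R w2 - (l3 w2 / D) *\<^sub>R w3"
    define d3 where "d3 = (l2 w2 / D) *\<^sub>R w3 - (l2 w3 / D) *\<^sub>R w2"
    have ld23: "l2 d2 = 1" "l3 d2 = 0" "l2 d3 = 0" "l3 d3 = 1"
      unfolding d2_def d3_def using False
      by (simp_all add: linear_diff[OF lin(1)] linear_diff[OF lin(2)] linear_scale[OF lin(1)]
          linear_scale[OF lin(2)] diff_divide_distrib[symmetric])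
        (simp_all add: D_def algebra_simps)
    then have l_span: "l2 (a *\<^sub>R d2 + b *\<^sub>R d3) = a" "l3 (a *\<^sub>R d2 + b *\<^sub>R d3) = b" for a b
      by (simp_all add: linear_add[OF lin(1)] linear_add[OF lin(2)] linear_scale[OF lin(1)]
          linear_scale[OF lin(2)])
    have w23: "w2 = l2 w2 *\<^sub>R d2 + l3 w2 *\<^sub>R d3" "w3 = l2 w3 *\<^sub>R d2 + l3 w3 *\<^sub>R d3"
    proof -
      have Dd: "D *\<^sub>R d2 = l3 w3 *\<^sub>R w2 - l3 w2 *\<^sub>R w3" "D *\<^sub>R d3 = l2 w2 *\<^sub>R w3 - l2 w3 *\<^sub>R w2"
        unfolding d2_def d3_def using False by (simp_all add: scaleR_diff_right)
      have distrib: "D *\<^sub>R (p *\<^sub>R d2 + q *\<^sub>R d3) = p *\<^sub>R (D *\<^sub>R d2) + q *\<^sub>R (D *\<^sub>R d3)" for p q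
        by (simp add: scaleR_add_right mult.commute)
      have "D *\<^sub>R (l2 w2 *\<^sub>R d2 + l3 w2 *\<^sub>R d3) = D *\<^sub>R w2"
        "D *\<^sub>R (l2 w3 *\<^sub>R d2 + l3 w3 *\<^sub>R d3) = D *\<^sub>R w3"
        unfolding distrib Dd by (simp_all add: D_def vec_eq_iff algebra_simps)
      then show "w2 = l2 w2 *\<^sub>R d2 + l3 w2 *\<^sub>R d3" "w3 = l2 w3 *\<^sub>R d2 + l3 w3 *\<^sub>R d3"
        using False by (metis scaleR_left_imp_eq)+
    qed
    have "v = Y1 v *\<^sub>R d + l2 v *\<^sub>R d2 + l3 v *\<^sub>R d3" for v
    proof -
      have "v = Y1 v *\<^sub>R d + Y2 v *\<^sub>R w2 + Y3 v *\<^sub>R w3"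
        by (simp add: coordsD(4)[OF cy])
      also have "\<dots> = Y1 v *\<^sub>R d + Y2 v *\<^sub>R (l2 w2 *\<^sub>R d2 + l3 w2 *\<^sub>R d3)
          + Y3 v *\<^sub>R (l2 w3 *\<^sub>R d2 + l3 w3 *\<^sub>R d3)"
        using w23 by simp
      also have "\<dots> = Y1 v *\<^sub>R d + l2 v *\<^sub>R d2 + l3 v *\<^sub>R d3"
        unfolding l_eq[OF lin(1) ld(1), of v] l_eq[OF lin(2) ld(2), of v]
        by (simp add: algebra_simps)
      finally show ?thesis .
    qed
    then have cy': "coords d d2 d3 Y1 l2 l3"
      unfolding coords_def using coordsD(1)[OF cy] lin by blast
    show ?thesis
    proof (rule sos_normal_form[OF cx cy' T])
      fix a b
      let ?w = "a *\<^sub>R d2 + b *\<^sub>R d3"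
      show "2 * \<beta> e1 e2 d ?w = a" "2 * \<beta> e1 e3 d ?w = b"
        using l_span[of a b] by (simp_all only: l2_def l3_def)
      show "\<beta> e1 e1 ?w ?w = a\<^sup>2 + b\<^sup>2"
        using ll[of ?w] by (simp only: l_span)
      show "a * \<beta> e1 e2 w w + b * \<beta> e1 e3 w w =
          a\<^sup>2 * \<beta> e2 e2 d w + 2 * a * b * \<beta> e2 e3 d w + b\<^sup>2 * \<beta> e3 e3 d w" if "w = ?w" for w
        using lB[of w] that by (simp only: l_span)
    qed
  qed
qed

text \<open>At a point \<open>d\<close> with \<open>T(d)\<close> nonzero, a kernel vector
  \<open>e\<close> is completed to a basis, and \<open>T(d)\<close> is diagonalized on the two other
  basis vectors. Its rank is one or two, and each case is already settled.\<close>

lemma sos_singular: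
  assumes sing: "\<And>y. \<exists>x. x \<noteq> 0 \<and> (\<forall>z. \<beta> x z y y = 0)"
  shows "sos (\<lambda>x y. \<beta> x x y y)"
proof (cases "\<forall>x y. \<beta> x x y y = 0")
  case True
  then show ?thesis using sos_zero by simp
next
  case False
  then obtain v d where vd: "\<beta> v v d d \<noteq> 0" by blast
  obtain e where e: "e \<noteq> 0" "\<And>z. \<beta> e z d d = 0" using sing by blast
  have key: ?thesis if co: "coords e a b X Y Z" and p0: "\<beta> a a d d \<noteq> 0" for a b X Y Z
  proof -
    define p q where "p = \<beta> a a d d" and "q = \<beta> a b d d"
    \<comment> \<open>One Gram-Schmidt step with respect to \<open>T(d)\<close>; then
      \<open>r = 0\<close> means rank one, and otherwise rescaling gives
      \<open>diag(0, 1, 1)\<close>.\<close>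
    define g where "g = b - (q / p) *\<^sub>R a"
    define r where "r = \<beta> g g d d"
    have p: "0 < p" using nonneg[of a d] p0 by (simp add: p_def)
    have ag: "\<beta> a g d d = 0"
      using p by (simp add: g_def expand p_def[symmetric] q_def[symmetric])
    define Y' where "Y' = (\<lambda>x. 1 * Y x + (q / p) * Z x)"
    have linY: "linear Y'" unfolding Y'_def by (intro linear_lincomb coordsD[OF co])
    have x_eq: "x = X x *\<^sub>R e + Y' x *\<^sub>R a + Z x *\<^sub>R g" for x
    proof -
      have "x = X x *\<^sub>R e + Y x *\<^sub>R a + Z x *\<^sub>R b" by (simp add: coordsD(4)[OF co])
      then show ?thesis by (simp add: Y'_def g_def algebra_simps)
    qed
    show ?thesis
    proof (cases "r = 0")
      case True
      have "\<beta> x x d d = (sqrt p * Y' x)\<^sup>2" for x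
      proof -
        have "\<beta> x x d d = \<beta> (X x *\<^sub>R e + Y' x *\<^sub>R a + Z x *\<^sub>R g) (X x *\<^sub>R e + Y' x *\<^sub>R a + Z x *\<^sub>R g) d d"
          using x_eq[of x] by simp
        also have "\<dots> = (sqrt p * Y' x)\<^sup>2"
          unfolding expand_coords_x e ag p_def[symmetric] r_def[symmetric]
          using p True by (simp add: power_mult_distrib)
        finally show ?thesis .
      qed
      moreover from this[of v] vd have "sqrt p * Y' v \<noteq> 0" by auto
      ultimately show ?thesis
        by (intro sos_rank_one[of "\<lambda>x. sqrt p * Y' x"] linear_cmult linY)
    next
      case False
      then have r: "0 < r" using nonneg[of g d] by (simp add: r_def)
      let ?a = "(1 / sqrt p) *\<^sub>R a" and ?g = "(1 / sqrt r) *\<^sub>R g"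
      have "coords e ?a ?g X (\<lambda>x. sqrt p * Y' x) (\<lambda>x. sqrt r * Z x)"
        unfolding coords_def using p r x_eq linY coordsD[OF co] by (simp add: linear_cmult)
      moreover have "\<beta> ?a ?a d d = 1" "\<beta> ?a ?g d d = 0" "\<beta> ?g ?g d d = 1"
        using p r ag by (simp_all add: expand p_def[symmetric] r_def[symmetric])
      ultimately show ?thesis
        using sos_rank_two[OF sing e(1)] e(2) by blast
    qed
  qed
  obtain a b X Y Z where co: "coords e a b X Y Z" using coords_exists[OF e(1)] .
  have "\<beta> a a d d \<noteq> 0 \<or> \<beta> b b d d \<noteq> 0"
  proof (rule ccontr)
    assume "\<not> ?thesis"
    then have "\<beta> a a d d = 0" "\<beta> b b d d = 0" by simp_all
    moreover from this(1) have "\<beta> a b d d = 0" by (rule isotropic_x)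
    ultimately have "\<beta> (X v *\<^sub>R e + Y v *\<^sub>R a + Z v *\<^sub>R b) (X v *\<^sub>R e + Y v *\<^sub>R a + Z v *\<^sub>R b) d d = 0"
      unfolding expand_coords_x e by simp
    with vd show False unfolding coordsD(4)[OF co] by simp
  qed
  then show ?thesis using key[OF co] key[OF coords_permute[OF co]] by blast
qed

end

section \<open>Polyconvexity from sums of squares\<close>

lemma convex_on_linear_square:
  fixes L :: "'a::real_vector \<Rightarrow> real"
  assumes "linear L"
  shows "convex_on UNIV (\<lambda>x. (L x)\<^sup>2)"
proof (rule convex_onI)
  fix t :: real and x y assume "0 < t" "t < 1"
  have "(1 - t) * (L x)\<^sup>2 + t * (L y)\<^sup>2 - ((1 - t) * L x + t * L y)\<^sup>2 = t * (1 - t) * (L x - L y)\<^sup>2"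
    by (simp add: power2_eq_square algebra_simps)
  moreover have "0 \<le> t * (1 - t) * (L x - L y)\<^sup>2"
    using \<open>0 < t\<close> \<open>t < 1\<close> by simp
  ultimately show "(L ((1 - t) *\<^sub>R x + t *\<^sub>R y))\<^sup>2 \<le> (1 - t) * (L x)\<^sup>2 + t * (L y)\<^sup>2"
    by (simp add: linear_add[OF assms] linear_scale[OF assms])
qed simp

lemma bilinear_axis_expansion:
  fixes b :: "real^3 \<Rightarrow> real^3 \<Rightarrow> real"
  assumes "bilinear b"
  shows "b x y = (\<Sum>i\<in>UNIV. \<Sum>j\<in>UNIV. b (axis i 1) (axis j 1) * (x $ i * y $ j))"
proof -
  have "b x y = b (\<Sum>i\<in>UNIV. x $ i *\<^sub>R axis i 1) (\<Sum>j\<in>UNIV. y $ j *\<^sub>R axis j 1)"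
    by (simp add: basis_expansion scalar_mult_eq_scaleR[symmetric])
  also have "\<dots> = (\<Sum>i\<in>UNIV. \<Sum>j\<in>UNIV. b (axis i 1) (axis j 1) * (x $ i * y $ j))"
    unfolding bilinear_sum[OF assms] sum.cartesian_product[symmetric]
    by (simp add: bilinear_lmul[OF assms] bilinear_rmul[OF assms] mult_ac)
  finally show ?thesis .
qed

text \<open>A bilinear form in \<open>(x, y)\<close> is a linear functional of
  \<open>outer x y\<close>. Its square thus extends to the square of a linear functional of the
  matrix, which is convex.\<close>

lemma sos_convex_extension:
  assumes "sos f"
  shows "\<exists>D. convex_on UNIV (quad_form D) \<and> (\<forall>x y. quad_form D (outer x y) = f x y)"
  using assms
proof induction
  case sos_zero
  show ?case
    by (intro exI[of _ "\<lambda>_ _ _ _. 0"]) (simp add: quad_form_def[abs_def] convex_on_const)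
next
  case (sos_add_square f b)
  then obtain D where D: "convex_on UNIV (quad_form D)" "\<And>x y. quad_form D (outer x y) = f x y"
    by blast
  define c where "c = (\<lambda>i j. b (axis i 1) (axis j 1))"
  define L where "L = (\<lambda>\<xi> :: real^3^3. \<Sum>i\<in>UNIV. \<Sum>j\<in>UNIV. c i j * \<xi> $ i $ j)"
  have "linear L"
    unfolding L_def linear_iff by (simp add: algebra_simps sum.distrib sum_distrib_left)
  have L: "L (outer x y) = b x y" for x y
    unfolding bilinear_axis_expansion[OF sos_add_square.hyps(2), of x y]
    by (simp add: L_def outer_def c_def)
  have eq: "quad_form (\<lambda>i j k l. D i j k l + c i j * c k l) = (\<lambda>\<xi>. quad_form D \<xi> + (L \<xi>)\<^sup>2)"
  proof
    fix \<xi> :: "real^3^3"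
    have "(L \<xi>)\<^sup>2 = (\<Sum>i\<in>UNIV. \<Sum>j\<in>UNIV. c i j * \<xi>$i$j * L \<xi>)"
      by (simp add: L_def power2_eq_square sum_distrib_right)
    also have "\<dots> = (\<Sum>i\<in>UNIV. \<Sum>j\<in>UNIV. \<Sum>k\<in>UNIV. \<Sum>l\<in>UNIV. c i j * c k l * \<xi>$i$j * \<xi>$k$l)"
      unfolding L_def sum_distrib_left by (simp add: mult_ac)
    finally show "quad_form (\<lambda>i j k l. D i j k l + c i j * c k l) \<xi> = quad_form D \<xi> + (L \<xi>)\<^sup>2"
      by (simp add: quad_form_def sum.distrib algebra_simps)
  qed
  show ?case
    by (intro exI[of _ "\<lambda>i j k l. D i j k l + c i j * c k l"], unfold eq)
      (simp add: D L convex_on_add convex_on_linear_square \<open>linear L\<close>)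
qed

section \<open>Quadratic forms that vanish on rank-one matrices\<close>

lemma quadratic_form_zero:
  fixes M :: "3 \<Rightarrow> 3 \<Rightarrow> real"
  assumes "\<And>x :: real^3. (\<Sum>i\<in>UNIV. \<Sum>k\<in>UNIV. M i k * (x $ i * x $ k)) = 0"
  shows "M i k + M k i = 0"
proof -
  have "M 1 1 = 0" "M 2 2 = 0" "M 3 3 = 0"
    using assms[of "axis 1 1"] assms[of "axis 2 1"] assms[of "axis 3 1"]
    by (simp_all add: sum_3 axis_def)
  moreover from this have "M 1 2 + M 2 1 = 0" "M 1 3 + M 3 1 = 0" "M 2 3 + M 3 2 = 0"
    using assms[of "axis 1 1 + axis 2 1"] assms[of "axis 1 1 + axis 3 1"] assms[of "axis 2 1 + axis 3 1"]
    by (simp_all add: sum_3 axis_def)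
  ultimately show ?thesis
    using exhaust_3[of i] exhaust_3[of k] by (elim disjE) (simp_all add: add.commute)
qed

text \<open>Coefficients are compared twice: first in \<open>x\<close> for fixed \<open>y\<close>,
  then in \<open>y\<close>.\<close>

lemma rank_one_null_form_coefficients:
  assumes "\<And>x y. quad_form H (outer x y) = 0"
  shows "H i j k l + H k j i l + (H i l k j + H k l i j) = 0"
proof -
  have "(\<Sum>j\<in>UNIV. \<Sum>l\<in>UNIV. (H i j k l + H k j i l) * (y $ j * y $ l)) = 0" for y :: "real^3"
  proof -
    define M where "M = (\<lambda>i k. \<Sum>j\<in>UNIV. \<Sum>l\<in>UNIV. H i j k l * (y $ j * y $ l))"
    have "quad_form H (outer x y) = (\<Sum>i\<in>UNIV. \<Sum>k\<in>UNIV. M i k * (x $ i * x $ k))" for x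
      unfolding quad_form_def M_def outer_def sum_distrib_right
      by (rule sum.cong[OF refl], subst sum.swap) (simp add: mult_ac)
    then have "M i k + M k i = 0"
      using assms by (intro quadratic_form_zero) simp
    then show ?thesis by (simp add: M_def sum.distrib[symmetric] algebra_simps)
  qed
  from quadratic_form_zero[OF this, of j l] show ?thesis by simp
qed

text \<open>After symmetrization the coefficients change sign when the two column indices are
  exchanged. The form is then a combination of differences
  \<open>\<xi>$i$j * \<xi>$k$l - \<xi>$i$l * \<xi>$k$j\<close>, which are minors of order two or
  zero.\<close>

lemma rank_one_null_form_cofactors:
  assumes "\<And>x y. quad_form H (outer x y) = 0"
  shows "\<exists>c. \<forall>\<xi>. quad_form H \<xi> = (\<Sum>i\<in>UNIV. \<Sum>j\<in>UNIV. c i j * cofactor_matrix \<xi> $ i $ j)"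
proof -
  \<comment> \<open>The factor \<open>1/4\<close> makes the sum over \<open>S\<close> half of the
    form; the other half comes from the sum with exchanged columns.\<close>
  define S where "S = (\<lambda>i j k l. (H i j k l + H k l i j) / 4)"
  \<comment> \<open>Each minor occurs for four index quadruples, two of them with the opposite
    sign.\<close>
  define c where "c = (\<lambda>i j. S (i+1) (j+1) (i+2) (j+2) + S (i+2) (j+2) (i+1) (j+1)
    - S (i+1) (j+2) (i+2) (j+1) - S (i+2) (j+1) (i+1) (j+2))"
  have anti: "S i l k j = - S i j k l" for i j k l
    using rank_one_null_form_coefficients[OF assms, of i j k l] unfolding S_def by argo
  have "quad_form H \<xi> = (\<Sum>i\<in>UNIV. \<Sum>j\<in>UNIV. c i j * cofactor_matrix \<xi> $ i $ j)" for \<xi>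
  proof -
    have idx: "(4::3) = 1" "(5::3) = 2" by simp_all
    have swap_pairs: "(\<Sum>i\<in>UNIV. \<Sum>j\<in>UNIV. \<Sum>k\<in>UNIV. \<Sum>l\<in>UNIV. F i j k l) =
        (\<Sum>i\<in>UNIV. \<Sum>j\<in>UNIV. \<Sum>k\<in>UNIV. \<Sum>l\<in>UNIV. F k l i j)" for F :: "3 \<Rightarrow> 3 \<Rightarrow> 3 \<Rightarrow> 3 \<Rightarrow> real"
      by (simp add: sum_3)
    have swap_inner: "(\<Sum>i\<in>UNIV. \<Sum>j\<in>UNIV. \<Sum>k\<in>UNIV. \<Sum>l\<in>UNIV. F i j k l) =
        (\<Sum>i\<in>UNIV. \<Sum>j\<in>UNIV. \<Sum>k\<in>UNIV. \<Sum>l\<in>UNIV. F i l k j)" for F :: "3 \<Rightarrow> 3 \<Rightarrow> 3 \<Rightarrow> 3 \<Rightarrow> real"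
      by (simp add: sum_3)
    let ?\<Sigma> = "\<lambda>F. \<Sum>i\<in>UNIV. \<Sum>j\<in>UNIV. \<Sum>k\<in>UNIV. \<Sum>l\<in>UNIV. (F i j k l :: real)"
    have "?\<Sigma> (\<lambda>i j k l. S i j k l * \<xi>$i$j * \<xi>$k$l) = quad_form H \<xi> / 4 + ?\<Sigma> (\<lambda>i j k l. H k l i j * \<xi>$k$l * \<xi>$i$j) / 4"
      unfolding quad_form_def
      by (simp add: S_def sum.distrib sum_divide_distrib add_divide_distrib algebra_simps)
    also have "\<dots> = quad_form H \<xi> / 2"
      unfolding quad_form_def by (subst (2) swap_pairs) simp
    finally have half: "?\<Sigma> (\<lambda>i j k l. S i j k l * \<xi>$i$j * \<xi>$k$l) = quad_form H \<xi> / 2" .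
    have "?\<Sigma> (\<lambda>i j k l. S i j k l * \<xi>$i$l * \<xi>$k$j) = ?\<Sigma> (\<lambda>i j k l. - (S i l k j * \<xi>$i$l * \<xi>$k$j))"
      by (intro sum.cong refl, subst anti) simp
    also have "\<dots> = - ?\<Sigma> (\<lambda>i j k l. S i l k j * \<xi>$i$l * \<xi>$k$j)"
      by (simp only: sum_negf)
    also have "\<dots> = - (quad_form H \<xi> / 2)"
      unfolding half[symmetric] by (subst swap_inner) (rule refl)
    finally have "quad_form H \<xi> = ?\<Sigma> (\<lambda>i j k l. S i j k l * \<xi>$i$j * \<xi>$k$l)
        - ?\<Sigma> (\<lambda>i j k l. S i j k l * \<xi>$i$l * \<xi>$k$j)"
      using half by simp
    also have "\<dots> = (\<Sum>i\<in>UNIV. \<Sum>j\<in>UNIV. c i j * cofactor_matrix \<xi> $ i $ j)"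
      by (simp add: sum_3 c_def cofactor_matrix_def idx algebra_simps)
    finally show ?thesis .
  qed
  then show ?thesis by blast
qed

text \<open>The convex form from \<open>sos_convex_extension\<close> and the given form agree on
  rank-one matrices, so they differ by a linear function of the cofactors.\<close>

lemma sos_imp_polyconvex:
  assumes "sos (\<lambda>x y. quad_form C (outer x y))"
  shows "polyconvex (quad_form C)"
proof -
  obtain D where D: "convex_on UNIV (quad_form D)" "\<And>x y. quad_form D (outer x y) = quad_form C (outer x y)"
    using sos_convex_extension[OF assms] by blast
  have diff: "quad_form (\<lambda>i j k l. C i j k l - D i j k l) \<xi> = quad_form C \<xi> - quad_form D \<xi>" for \<xi>
    by (simp add: quad_form_def sum_subtractf algebra_simps)
  obtain c where c: "\<And>\<xi>. quad_form C \<xi> - quad_form D \<xi> =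
      (\<Sum>i\<in>UNIV. \<Sum>j\<in>UNIV. c i j * cofactor_matrix \<xi> $ i $ j)"
    using rank_one_null_form_cofactors[of "\<lambda>i j k l. C i j k l - D i j k l"] D(2)
    unfolding diff by auto
  define g :: "(real^3^3) \<times> (real^3^3) \<times> real \<Rightarrow> real" where
    "g = (\<lambda>p. quad_form D (fst p) + (\<Sum>i\<in>UNIV. \<Sum>j\<in>UNIV. c i j * fst (snd p) $ i $ j))"
  have "convex_on UNIV g"
  proof (rule convex_onI)
    fix t :: real and p q :: "(real^3^3) \<times> (real^3^3) \<times> real" assume "0 < t" "t < 1"
    then have "quad_form D ((1 - t) *\<^sub>R fst p + t *\<^sub>R fst q) \<le>
        (1 - t) * quad_form D (fst p) + t * quad_form D (fst q)"
      using convex_onD[OF D(1)] by simp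
    then show "g ((1 - t) *\<^sub>R p + t *\<^sub>R q) \<le> (1 - t) * g p + t * g q"
      by (simp add: g_def algebra_simps sum.distrib sum_distrib_left sum_subtractf)
  qed simp
  moreover have "quad_form C \<xi> = g (\<xi>, cofactor_matrix \<xi>, det \<xi>)" for \<xi>
    using c[of \<xi>] by (simp add: g_def)
  ultimately show ?thesis unfolding polyconvex_def by blast
qed

text \<open>The two symmetries of \<open>C\<close> make the polarization symmetric in each pair of
  arguments, and a vanishing determinant supplies the kernel vectors for
  \<open>sos_singular\<close>.\<close>

lemma sos_of_det_zero:
  fixes C :: "3 \<Rightarrow> 3 \<Rightarrow> 3 \<Rightarrow> 3 \<Rightarrow> real"
  assumes sym1: "\<And>i j k l. C i j k l = C k j i l"
    and sym2: "\<And>i j k l. C i j k l = C i l k j"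
    and nonneg: "\<And>x y. 0 \<le> quad_form C (outer x y)"
    and det0: "\<And>y. det (acoustic C y) = 0"
  shows "sos (\<lambda>x y. quad_form C (outer x y))"
proof -
  define \<beta> :: "real^3 \<Rightarrow> real^3 \<Rightarrow> real^3 \<Rightarrow> real^3 \<Rightarrow> real" where
    "\<beta> = (\<lambda>x x' y y'. \<Sum>i\<in>UNIV. \<Sum>k\<in>UNIV. \<Sum>j\<in>UNIV. \<Sum>l\<in>UNIV.
      C i j k l * (x $ i * x' $ k * (y $ j * y' $ l)))"
  have \<beta>: "\<beta> x x y y = quad_form C (outer x y)" for x y
    unfolding \<beta>_def quad_form_def outer_def
    by (rule sum.cong[OF refl], subst sum.swap) (simp add: mult_ac)
  interpret biquadratic \<beta>
  proof
    show "symbilinear (\<lambda>x x'. \<beta> x x' y y')" for y y'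
      unfolding symbilinear_def
    proof (intro conjI allI)
      show "bilinear (\<lambda>x x'. \<beta> x x' y y')"
        unfolding bilinear_def linear_iff \<beta>_def
        by (simp add: sum.distrib sum_distrib_left algebra_simps)
      show "\<beta> x x' y y' = \<beta> x' x y y'" for x x'
        unfolding \<beta>_def by (subst sum.swap, subst sym1) (simp add: mult_ac)
    qed
    show "symbilinear (\<lambda>y y'. \<beta> x x' y y')" for x x'
      unfolding symbilinear_def
    proof (intro conjI allI)
      show "bilinear (\<lambda>y y'. \<beta> x x' y y')"
        unfolding bilinear_def linear_iff \<beta>_def
        by (simp add: sum.distrib sum_distrib_left algebra_simps)
      show "\<beta> x x' y y' = \<beta> x x' y' y" for y y'
        unfolding \<beta>_def
        by (rule sum.cong[OF refl], rule sum.cong[OF refl], subst sum.swap, subst sym2) (simp add: mult_ac)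
    qed
    show "0 \<le> \<beta> x x y y" for x y
      by (simp add: \<beta> nonneg)
  qed
  have "\<exists>x. x \<noteq> 0 \<and> (\<forall>z. \<beta> x z y y = 0)" for y
  proof -
    obtain x where x: "x \<noteq> 0" "acoustic C y *v x = 0"
      using det0[of y] by (metis invertible_det_nz invertible_left_inverse matrix_left_invertible_ker)
    have "\<beta> z x y y = z \<bullet> (acoustic C y *v x)" for z
      by (simp add: \<beta>_def acoustic_def inner_vec_def matrix_vector_mult_def sum_distrib_left
          sum_distrib_right mult_ac)
    then show ?thesis using x commute_x by (metis inner_zero_right)
  qed
  from sos_singular[OF this] show ?thesis by (simp add: \<beta>)
qed

section \<open>Quasiconvexity implies rank-one nonnegativity\<close>

text \<open>Whatever the signs of \<open>t\<close> and \<open>t + e\<close>, the error of the linear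
  approximation is at most \<open>e^2\<close>.\<close>

lemma DERIV_positive_part_square:
  "((\<lambda>t :: real. (max 0 t)\<^sup>2) has_real_derivative 2 * max 0 t) (at t)"
proof -
  have bound: "\<bar>(max 0 (t + e))\<^sup>2 - (max 0 t)\<^sup>2 - 2 * max 0 t * e\<bar> \<le> e\<^sup>2" for e :: real
  proof -
    consider "0 \<le> t" "0 \<le> t + e" | "0 \<le> t" "t + e < 0" | "t < 0" "t + e \<le> 0" | "t < 0" "0 < t + e"
      by linarith
    then show ?thesis
    proof cases
      case 2
      then have "0 \<le> t * (- 2 * e - t)" "0 \<le> (t + e)\<^sup>2" by auto
      then show ?thesis using 2 by (simp add: max_def power2_eq_square algebra_simps abs_le_iff)
    next
      case 4
      then have "(t + e)\<^sup>2 \<le> e\<^sup>2" by (intro power_mono) auto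
      then show ?thesis using 4 by (simp add: max_def)
    qed (simp_all add: max_def power2_eq_square algebra_simps)
  qed
  have "\<forall>\<^sub>F e in at 0. norm (((max 0 (t + e))\<^sup>2 - (max 0 t)\<^sup>2) / e - 2 * max 0 t) \<le> \<bar>e\<bar>"
    unfolding eventually_at_filter
  proof (intro always_eventually allI impI)
    fix e :: real assume "e \<noteq> 0"
    then have "((max 0 (t + e))\<^sup>2 - (max 0 t)\<^sup>2) / e - 2 * max 0 t =
        ((max 0 (t + e))\<^sup>2 - (max 0 t)\<^sup>2 - 2 * max 0 t * e) / e"
      by (simp add: field_simps)
    moreover have "\<bar>e\<bar> * \<bar>e\<bar> = e\<^sup>2" by (simp add: power2_eq_square)
    ultimately show "norm (((max 0 (t + e))\<^sup>2 - (max 0 t)\<^sup>2) / e - 2 * max 0 t) \<le> \<bar>e\<bar>"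
      using bound[of e] \<open>e \<noteq> 0\<close> by (simp add: abs_divide pos_divide_le_eq)
  qed
  moreover have "((\<lambda>e :: real. \<bar>e\<bar>) \<longlongrightarrow> 0) (at 0)"
    by (auto intro!: tendsto_eq_intros)
  ultimately have "((\<lambda>e. ((max 0 (t + e))\<^sup>2 - (max 0 t)\<^sup>2) / e - 2 * max 0 t) \<longlongrightarrow> 0) (at 0)"
    by (rule Lim_null_comparison)
  then show ?thesis
    unfolding DERIV_def by (rule LIM_zero_cancel)
qed

text \<open>Squaring the positive part makes the function continuously differentiable across the
  unit sphere, as test fields require.\<close>

definition bump :: "real^3 \<Rightarrow> real" where
  "bump x = (max 0 (1 - x \<bullet> x))\<^sup>2"

definition bump_grad :: "real^3 \<Rightarrow> real^3" where
  "bump_grad x = (- 4 * max 0 (1 - x \<bullet> x)) *\<^sub>R x"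

lemma bump_has_derivative: "(bump has_derivative (\<lambda>h. bump_grad x \<bullet> h)) (at x)"
proof -
  have "((\<lambda>x :: real^3. 1 - x \<bullet> x) has_derivative (\<lambda>h. - 2 * (x \<bullet> h))) (at x)"
    by (auto intro!: derivative_eq_intros simp: inner_commute)
  from has_derivative_compose[OF this DERIV_positive_part_square[THEN has_field_derivative_imp_has_derivative]]
  show ?thesis
    unfolding bump_def[abs_def] by (rule has_derivative_eq_rhs) (simp add: bump_grad_def fun_eq_iff)
qed

lemma bump_eq_0: "1 \<le> norm x \<Longrightarrow> bump x = 0"
  using power_mono[of 1 "norm x" 2] by (simp add: bump_def power2_norm_eq_inner)

lemma continuous_on_bump: "continuous_on S bump" "continuous_on S bump_grad"
  unfolding bump_def[abs_def] bump_grad_def[abs_def] by (intro continuous_intros)+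

lemma continuous_on_quad_form:
  fixes g :: "real^3 \<Rightarrow> real^3^3"
  assumes "continuous_on S g"
  shows "continuous_on S (\<lambda>x. quad_form C (g x))"
  unfolding quad_form_def by (intro continuous_intros assms)

lemma outer_mult_vec: "outer a v *v h = (v \<bullet> h) *\<^sub>R a"
  by (simp add: vec_eq_iff outer_def matrix_vector_mult_def inner_vec_def sum_distrib_left mult_ac)

lemma continuous_on_outer:
  assumes "continuous_on S g"
  shows "continuous_on S (\<lambda>x. outer a (g x))"
  unfolding outer_def by (intro continuous_intros continuous_on_vec_lambda assms)

text \<open>The field \<open>u(x) a\<close> has gradient \<open>outer a (g x)\<close>, and
  quasiconvexity is tested at the zero matrix. The open box is large enough to contain the closed
  unit ball, which serves as the compact set.\<close>

lemma quasiconvex_scalar_test: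
  assumes qc: "quasiconvex (quad_form C)"
    and deriv: "\<And>x. (u has_derivative (\<lambda>h. g x \<bullet> h)) (at x)"
    and cont: "continuous_on UNIV g"
    and supp: "\<And>x. 1 \<le> norm x \<Longrightarrow> u x = 0"
  shows "0 \<le> integral (box (- (2 *\<^sub>R One)) (2 *\<^sub>R One)) (\<lambda>x. quad_form C (outer a (g x)))"
proof -
  let ?D = "box (- (2 *\<^sub>R One)) (2 *\<^sub>R One) :: (real^3) set"
  have "cball 0 1 \<subseteq> ?D"
  proof
    fix x :: "real^3" assume "x \<in> cball 0 1"
    then have "\<bar>x \<bullet> i\<bar> \<le> 1" if "i \<in> Basis" for i
      using Basis_le_norm[OF that, of x] by simp
    then have "\<bar>x \<bullet> i\<bar> < 2" if "i \<in> Basis" for i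
      using that by fastforce
    then show "x \<in> ?D"
      by (simp add: mem_box abs_less_iff minus_less_iff)
  qed
  moreover have "\<forall>x. x \<notin> cball 0 1 \<longrightarrow> u x *\<^sub>R a = 0"
    using supp by simp
  ultimately have "test_field ?D (\<lambda>x. u x *\<^sub>R a) (\<lambda>x. outer a (g x))"
    unfolding test_field_def outer_mult_vec
    by (intro conjI allI exI[of _ "cball 0 1"] has_derivative_scaleR_left[OF deriv]
        continuous_on_outer[OF cont] compact_cball) simp_all
  from qc[unfolded quasiconvex_def, rule_format, OF open_box bounded_box this, of 0]
  show ?thesis by (simp add: quad_form_def)
qed

text \<open>Only the shape of the cross term matters: its contributions from the sine and cosine
  fields cancel.\<close>

lemma quad_form_outer_combination:
  obtains K where "\<And>p q. quad_form C (outer a (p *\<^sub>R v + q *\<^sub>R w)) =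
    p\<^sup>2 * quad_form C (outer a v) + p * q * K + q\<^sup>2 * quad_form C (outer a w)"
proof
  show "quad_form C (outer a (p *\<^sub>R v + q *\<^sub>R w)) = p\<^sup>2 * quad_form C (outer a v)
    + p * q * (\<Sum>i\<in>UNIV. \<Sum>j\<in>UNIV. \<Sum>k\<in>UNIV. \<Sum>l\<in>UNIV. C i j k l * a $ i * a $ k * (v $ j * w $ l + w $ j * v $ l))
    + q\<^sup>2 * quad_form C (outer a w)" for p q
    unfolding quad_form_def outer_def
    by (simp add: sum_distrib_left sum.distrib[symmetric] power2_eq_square algebra_simps)
qed

text \<open>Adding the tests with the sine and cosine fields of frequency \<open>n\<close> removes
  the oscillation and leaves \<open>J + n^2 q I\<close>. If \<open>q < 0\<close>, this is negative
  for large \<open>n\<close>, since \<open>I\<close> is positive.\<close>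

lemma quasiconvex_rank_one:
  assumes "quasiconvex (quad_form C)"
  shows "0 \<le> quad_form C (outer a y)"
proof (rule ccontr)
  define q where "q = quad_form C (outer a y)"
  assume "\<not> 0 \<le> quad_form C (outer a y)"
  then have q: "q < 0" by (simp add: q_def)
  let ?D = "box (- (2 *\<^sub>R One)) (2 *\<^sub>R One) :: (real^3) set"
  let ?E = "cbox (- (2 *\<^sub>R One)) (2 *\<^sub>R One) :: (real^3) set"
  have int: "h integrable_on ?D" if "continuous_on UNIV h" for h :: "real^3 \<Rightarrow> real"
    unfolding integrable_on_open_interval
    by (rule integrable_continuous, rule continuous_on_subset[OF that]) simp
  define J where "J = integral ?D (\<lambda>x. quad_form C (outer a (bump_grad x)))"
  define I where "I = integral ?D (\<lambda>x. (bump x)\<^sup>2)"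
  have "0 \<le> J + n\<^sup>2 * q * I" for n
  proof -
    define u where "u = (\<lambda>x. bump x * sin (n * (y \<bullet> x)))"
    define v where "v = (\<lambda>x. bump x * cos (n * (y \<bullet> x)))"
    define gu where "gu = (\<lambda>x. sin (n * (y \<bullet> x)) *\<^sub>R bump_grad x + (n * bump x * cos (n * (y \<bullet> x))) *\<^sub>R y)"
    define gv where "gv = (\<lambda>x. cos (n * (y \<bullet> x)) *\<^sub>R bump_grad x + (- (n * bump x * sin (n * (y \<bullet> x)))) *\<^sub>R y)"
    have du: "(u has_derivative (\<lambda>h. gu x \<bullet> h)) (at x)" for x
      unfolding u_def gu_def
      by (auto intro!: derivative_eq_intros bump_has_derivative simp: inner_add_left algebra_simps)
    have dv: "(v has_derivative (\<lambda>h. gv x \<bullet> h)) (at x)" for x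
      unfolding v_def gv_def
      by (auto intro!: derivative_eq_intros bump_has_derivative
          simp: inner_add_left inner_diff_left algebra_simps)
    have cont: "continuous_on UNIV gu" "continuous_on UNIV gv"
      unfolding gu_def gv_def by (intro continuous_intros continuous_on_bump)+
    have sum: "quad_form C (outer a (gu x)) + quad_form C (outer a (gv x)) =
        quad_form C (outer a (bump_grad x)) + n\<^sup>2 * q * (bump x)\<^sup>2" for x
    proof -
      obtain K where K: "\<And>s t. quad_form C (outer a (s *\<^sub>R bump_grad x + t *\<^sub>R y)) =
          s\<^sup>2 * quad_form C (outer a (bump_grad x)) + s * t * K + t\<^sup>2 * quad_form C (outer a y)"
        using quad_form_outer_combination[of C a "bump_grad x" y] by blast
      define S where "S = sin (n * (y \<bullet> x))"
      define T where "T = cos (n * (y \<bullet> x))"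
      have T: "T\<^sup>2 = 1 - S\<^sup>2"
        unfolding S_def T_def by (rule cos_squared_eq)
      show ?thesis
        unfolding gu_def gv_def K S_def[symmetric] T_def[symmetric] q_def[symmetric]
        by (simp add: power_mult_distrib T) (simp add: algebra_simps)
    qed
    have "0 \<le> integral ?D (\<lambda>x. quad_form C (outer a (gu x))) + integral ?D (\<lambda>x. quad_form C (outer a (gv x)))"
      by (intro add_nonneg_nonneg quasiconvex_scalar_test[OF assms du cont(1)]
          quasiconvex_scalar_test[OF assms dv cont(2)]) (simp_all add: u_def v_def bump_eq_0)
    also have "\<dots> = integral ?D (\<lambda>x. quad_form C (outer a (gu x)) + quad_form C (outer a (gv x)))"
      by (intro integral_add[symmetric] int continuous_on_quad_form continuous_on_outer cont)
    also have "\<dots> = integral ?D (\<lambda>x. quad_form C (outer a (bump_grad x)) + n\<^sup>2 * q * (bump x)\<^sup>2)"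
      by (simp add: sum)
    also have "\<dots> = J + integral ?D (\<lambda>x. n\<^sup>2 * q * (bump x)\<^sup>2)"
      unfolding J_def
      by (intro integral_add int continuous_on_quad_form continuous_on_outer continuous_intros
          continuous_on_bump)
    also have "\<dots> = J + n\<^sup>2 * q * I"
      by (simp add: I_def)
    finally show ?thesis .
  qed
  note J = this
  \<comment> \<open>A continuous nonnegative function with zero integral over the closed box
    vanishes there, but \<open>bump 0 = 1\<close>.\<close>
  have "I \<noteq> 0"
  proof
    assume "I = 0"
    have cont: "continuous_on UNIV (\<lambda>x. (bump x)\<^sup>2)"
      by (intro continuous_intros continuous_on_bump)
    have "((\<lambda>x. (bump x)\<^sup>2) has_integral 0) ?E"
      using integrable_integral[OF int[OF cont]] \<open>I = 0\<close> by (simp add: I_def has_integral_open_interval)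
    moreover have "?D \<noteq> {}" "0 \<in> ?E"
      by (simp_all add: box_ne_empty mem_box)
    ultimately have "(bump 0)\<^sup>2 = 0"
      using has_integral_0_cbox_imp_0[OF continuous_on_subset[OF cont], of "- (2 *\<^sub>R One)" "2 *\<^sub>R One" 0] by simp
    then show False by (simp add: bump_def)
  qed
  moreover have "0 \<le> I"
    unfolding I_def by (rule integral_nonneg[OF int]) (intro continuous_intros continuous_on_bump, simp)
  ultimately have "0 < - q * I"
    using q by (simp add: mult_neg_pos)
  then obtain n :: nat where "J < n * (- q * I)"
    using ex_less_of_nat_mult by blast
  \<comment> \<open>A natural number is at most its square.\<close>
  also have "\<dots> \<le> (real n)\<^sup>2 * (- q * I)"
    using \<open>0 < - q * I\<close> by (intro mult_right_mono) (simp_all add: power2_eq_square flip: of_nat_mult)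
  finally show False using J[of "real n"] by (simp add: algebra_simps)
qed

theorem theorem2p2:
  fixes C :: "3 \<Rightarrow> 3 \<Rightarrow> 3 \<Rightarrow> 3 \<Rightarrow> real"
  assumes sym1: "\<And>i j k l. C i j k l = C k j i l"
    and sym2: "\<And>i j k l. C i j k l = C i l k j"
    and qc: "quad_form C \<in> quasiconvex_quadratic_forms"
    and det0: "\<And>y. det (acoustic C y) = 0"
  shows "polyconvex (quad_form C)"
proof -
  have "quasiconvex (quad_form C)"
    using qc by (simp add: quad_form_mem_iff)
  then have "sos (\<lambda>x y. quad_form C (outer x y))"
    by (intro sos_of_det_zero sym1 sym2 det0 quasiconvex_rank_one)
  then show ?thesis by (rule sos_imp_polyconvex)
qed

end
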